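(* Fix an integer $d\ge2$ and a class $\mathcal{P}$ of graphs that is block-hereditary, recognizable in polynomial time, and consists only of chordal graphs. Let $(G_1,S)$, $(G_2,S)$, $(H,S)$ be $d$-labeled $\mathcal{P}$-block boundaried graphs such that (i) for each $i\in\{1,2\}$, $(G_i,S)$ is compatible with $(H,S)$; (ii) $(G_1,S)$ and $(G_2,S)$ have the same characteristic $(g,h)$; and (iii) $\mathbf{Aux}(G_2,S)\oplus\mathbf{Aux}(H,S)$ has no cycles. If $(G_1,S)\oplus(H,S)$ is a $d$-labeled $\mathcal{P}$-block graph that respects $(g,h)$, then $(G_2,S)\oplus(H,S)$ is a $d$-labeled $\mathcal{P}$-block graph that respects $(g,h)$.
   Context: A graph is biconnected if connected with no cut vertex; a block is a maximal biconnected subgraph; a block is non-trivial if it has at least two vertices. A graph is chordal if it has no induced cycle of length at least $4$. $\mathcal{P}$ is block-hereditary if every biconnected induced subgraph of a graph in $\mathcal{P}$ is in $\mathcal{P}$. A $\mathcal{P}$-block graph is a graph all of whose blocks lie in $\mathcal{P}$. A block $d$-labeling of a graph whose blocks have at most $d$ vertices is a map $L:V(G)\to[d]$ injective on each block; a $d$-labeled $\mathcal{P}$-block graph is a $\mathcal{P}$-block graph with a block $d$-labeling. Two $d$-labeled graphs are label-isomorphic if there is a label-preserving isomorphism; a biconnected $d$-labeled graph $F$ is partially label-isomorphic to a biconnected $d$-labeled graph $Q$ if $F$ is label-isomorphic to the subgraph of $Q$ induced by the vertices whose labels appear in $F$. $\mathcal{U}_d$ is the set of all biconnected $d$-labeled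 $\mathcal{P}$-block graphs. A boundaried graph is a pair $(G,S)$ with $S\subseteq V(G)$; $\mathrm{Block}(G,S)$ is the set of non-trivial blocks of $G[S]$; an $S$-block of $G$ is a block of $G$ containing an edge of $G[S]$ (each $B\in\mathrm{Block}(G,S)$ lies in a unique $S$-block). $d$-labeled $(G,S),(H,S)$ are compatible if $V(G-S)\cap V(H-S)=\emptyset$, $G[S]=H[S]$ and labels agree on $S$; their sum $(G,S)\oplus(H,S)$ is the disjoint union of $G$ and $H$ with corresponding vertices of $S$ identified and duplicate edges inside $S$ removed, labeled by $L_G\oplus L_H$ (each vertex gets its label from $G$ or $H$). For a $d$-labeled $(G,S)$ with labeling $L$, a characteristic of $(G,S)$ is a pair $(g,h)$ with $g:\mathrm{Block}(G,S)\to\mathcal{U}_d$ and $h:\mathrm{Block}(G,S)\to 2^{[d]}$ such that for each $B\in\mathrm{Block}(G,S)$ and the $S$-block $X$ of $G$ containing $B$: (a) $X$ is partially label-isomorphic to $g(B)$; (b) $g(B')=g(B)$ for every $B'\in\mathrm{Block}(G,S)$ contained in $X$; (c) $h(B)=L(N_X(V(B))\setminus S)$; (d) for every vertex $w$ with $w\in V(X)\setminus S$ or with $\{w\}=V(X)\cap V(C)$ for some component $C$ of $G[S]$, $X[N_X[w]]$ is label-isomorphic to $g(B)[N_{g(B)}[z]]$, where $z$ is the vertex of $g(B)$ with label $L(w)$. For $(G,S)$ with characteristic $(g,h)$ and a compatible $(H,S)$, the sum $(G,S)\oplus(H,S)$ respects $(g,h)$ if for each $B\in\mathrm{Block}(G,S)$,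 the $S$-block of the sum containing $B$ (a block of the sum containing an edge of $G[S]$) is label-isomorphic to $g(B)$. $\mathbf{Aux}(G,S)$ is the bipartite graph whose vertices are the connected components of $G$ and of $G[S]$, a component $C_1$ of $G$ adjacent to a component $C_2$ of $G[S]$ iff $C_2\subseteq C_1$; $\mathbf{Aux}(G,S)\oplus\mathbf{Aux}(H,S)$ is their disjoint union with vertices corresponding to the same component of $G[S]=H[S]$ identified. *)

theory Defs
  imports Main
begin

type_synonym 'v graph = "'v set \<times> 'v set set"

definition verts :: "'v graph \<Rightarrow> 'v set" where "verts G = fst G"
definition edges :: "'v graph \<Rightarrow> 'v set set" where "edges G = snd G"

definition wf_graph :: "'v graph \<Rightarrow> bool" where
  "wf_graph G \<longleftrightarrow> finite (verts G) \<and>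
     (\<forall>e\<in>edges G. \<exists>u v. e = {u, v} \<and> u \<noteq> v \<and> u \<in> verts G \<and> v \<in> verts G)"

definition adj :: "'v graph \<Rightarrow> 'v \<Rightarrow> 'v \<Rightarrow> bool" where
  "adj G u v \<longleftrightarrow> u \<noteq> v \<and> {u, v} \<in> edges G"

definition induced :: "'v graph \<Rightarrow> 'v set \<Rightarrow> 'v graph" where
  "induced G S = (verts G \<inter> S, {e \<in> edges G. e \<subseteq> S})"

definition connected :: "'v graph \<Rightarrow> bool" where
  "connected G \<longleftrightarrow> verts G \<noteq> {} \<and> (\<forall>u\<in>verts G. \<forall>v\<in>verts G. (adj G)\<^sup>*\<^sup>* u v)"

text \<open>Biconnected: connected and no cut vertex (K1 and K2 are biconnected).\<close>
definition biconnected :: "'v graph \<Rightarrow> bool" where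
  "biconnected G \<longleftrightarrow> connected G \<and>
     (card (verts G) \<ge> 2 \<longrightarrow> (\<forall>v\<in>verts G. connected (induced G (verts G - {v}))))"

text \<open>Blocks (maximal biconnected subgraphs) are induced, so we represent them by vertex sets.\<close>
definition blocks :: "'v graph \<Rightarrow> 'v set set" where
  "blocks G = {B. B \<subseteq> verts G \<and> biconnected (induced G B) \<and>
     (\<forall>B'. B \<subseteq> B' \<and> B' \<subseteq> verts G \<and> biconnected (induced G B') \<longrightarrow> B' = B)}"

definition components :: "'v graph \<Rightarrow> 'v set set" where
  "components G = {C. C \<subseteq> verts G \<and> connected (induced G C) \<and>
     (\<forall>C'. C \<subseteq> C' \<and> C' \<subseteq> verts G \<and> connected (induced G C') \<longrightarrow> C' = C)}"

definition graph_iso :: "'v graph \<Rightarrow> 'w graph \<Rightarrow> ('v \<Rightarrow> 'w) \<Rightarrow> bool" where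
  "graph_iso G1 G2 f \<longleftrightarrow> bij_betw f (verts G1) (verts G2) \<and>
     (\<forall>u\<in>verts G1. \<forall>v\<in>verts G1. adj G1 u v \<longleftrightarrow> adj G2 (f u) (f v))"

definition graph_class :: "'v graph set \<Rightarrow> bool" where
  "graph_class P \<longleftrightarrow> (\<forall>G\<in>P. wf_graph G) \<and>
     (\<forall>G1 G2 f. G1 \<in> P \<and> wf_graph G2 \<and> graph_iso G1 G2 f \<longrightarrow> G2 \<in> P)"

text \<open>Chordal: no induced cycle of length at least 4 (an induced connected 2-regular subgraph).\<close>
definition chordal :: "'v graph \<Rightarrow> bool" where
  "chordal G \<longleftrightarrow> \<not> (\<exists>C\<subseteq>verts G. card C \<ge> 4 \<and> connected (induced G C) \<and>
      (\<forall>v\<in>C. card {u\<in>C. adj G v u} = 2))"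

definition block_hereditary :: "'v graph set \<Rightarrow> bool" where
  "block_hereditary P \<longleftrightarrow>
     (\<forall>G\<in>P. \<forall>S\<subseteq>verts G. biconnected (induced G S) \<longrightarrow> induced G S \<in> P)"

definition P_block_graph :: "'v graph set \<Rightarrow> 'v graph \<Rightarrow> bool" where
  "P_block_graph P G \<longleftrightarrow> wf_graph G \<and> (\<forall>B\<in>blocks G. induced G B \<in> P)"

definition block_labeling :: "nat \<Rightarrow> 'v graph \<Rightarrow> ('v \<Rightarrow> nat) \<Rightarrow> bool" where
  "block_labeling d G L \<longleftrightarrow> (\<forall>B\<in>blocks G. card B \<le> d) \<and> L ` verts G \<subseteq> {1..d} \<and>
     (\<forall>B\<in>blocks G. inj_on L B)"

definition d_labeled_P_block :: "nat \<Rightarrow> 'v graph set \<Rightarrow> 'v graph \<Rightarrow> ('v \<Rightarrow> nat) \<Rightarrow> bool" where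
  "d_labeled_P_block d P G L \<longleftrightarrow> P_block_graph P G \<and> block_labeling d G L"

definition label_iso :: "'v graph \<times> ('v \<Rightarrow> nat) \<Rightarrow> 'w graph \<times> ('w \<Rightarrow> nat) \<Rightarrow> bool" where
  "label_iso F Q \<longleftrightarrow> (\<exists>f. graph_iso (fst F) (fst Q) f \<and>
     (\<forall>v\<in>verts (fst F). snd Q (f v) = snd F v))"

definition partial_label_iso :: "'v graph \<times> ('v \<Rightarrow> nat) \<Rightarrow> 'w graph \<times> ('w \<Rightarrow> nat) \<Rightarrow> bool" where
  "partial_label_iso F Q \<longleftrightarrow>
     label_iso F (induced (fst Q) {v\<in>verts (fst Q). snd Q v \<in> snd F ` verts (fst F)}, snd Q)"

definition U :: "nat \<Rightarrow> 'v graph set \<Rightarrow> ('v graph \<times> ('v \<Rightarrow> nat)) set" where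
  "U d P = {(Q, LQ). biconnected Q \<and> d_labeled_P_block d P Q LQ}"

definition block_set :: "'v graph \<Rightarrow> 'v set \<Rightarrow> 'v set set" where
  "block_set G S = {B\<in>blocks (induced G S). card B \<ge> 2}"

definition nbhd_in :: "'v graph \<Rightarrow> 'v set \<Rightarrow> 'v set \<Rightarrow> 'v set" where
  "nbhd_in G X A = {u\<in>X. \<exists>a\<in>A. adj G a u}"

definition cnbhd_in :: "'v graph \<Rightarrow> 'v set \<Rightarrow> 'v \<Rightarrow> 'v set" where
  "cnbhd_in G X w = insert w {u\<in>X. adj G w u}"

text \<open>Characteristic (g,h) of the d-labeled boundaried graph (G,S) with labeling L.
  For B in Block(G,S), X ranges over the (unique) block of G containing B, i.e. the S-block of B.\<close>
definition characteristic ::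
  "nat \<Rightarrow> 'v graph set \<Rightarrow> 'v graph \<Rightarrow> ('v \<Rightarrow> nat) \<Rightarrow> 'v set \<Rightarrow>
   ('v set \<Rightarrow> 'v graph \<times> ('v \<Rightarrow> nat)) \<Rightarrow> ('v set \<Rightarrow> nat set) \<Rightarrow> bool" where
  "characteristic d P G L S g h \<longleftrightarrow>
    (\<forall>B\<in>block_set G S. g B \<in> U d P \<and> h B \<subseteq> {1..d} \<and>
      (\<forall>X\<in>blocks G. B \<subseteq> X \<longrightarrow>
         partial_label_iso (induced G X, L) (g B) \<and>
         (\<forall>B'\<in>block_set G S. B' \<subseteq> X \<longrightarrow> g B' = g B) \<and>
         h B = L ` (nbhd_in G X B - S) \<and>
         (\<forall>w. (w \<in> X - S \<or> (\<exists>C\<in>components (induced G S). X \<inter> C = {w})) \<longrightarrow>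
            (\<forall>z\<in>verts (fst (g B)). snd (g B) z = L w \<longrightarrow>
               label_iso (induced G (cnbhd_in G X w), L)
                 (induced (fst (g B)) (cnbhd_in (fst (g B)) (verts (fst (g B))) z), snd (g B))))))"

definition compatible ::
  "'v graph \<Rightarrow> ('v \<Rightarrow> nat) \<Rightarrow> 'v graph \<Rightarrow> ('v \<Rightarrow> nat) \<Rightarrow> 'v set \<Rightarrow> bool" where
  "compatible G LG H LH S \<longleftrightarrow> S \<subseteq> verts G \<and> S \<subseteq> verts H \<and>
     (verts G - S) \<inter> (verts H - S) = {} \<and> induced G S = induced H S \<and>
     (\<forall>v\<in>S. LG v = LH v)"

definition gsum :: "'v graph \<Rightarrow> 'v graph \<Rightarrow> 'v graph" where
  "gsum G H = (verts G \<union> verts H, edges G \<union> edges H)"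

definition lsum :: "'v graph \<Rightarrow> ('v \<Rightarrow> nat) \<Rightarrow> ('v \<Rightarrow> nat) \<Rightarrow> 'v \<Rightarrow> nat" where
  "lsum G LG LH v = (if v \<in> verts G then LG v else LH v)"

definition respects_char ::
  "'v graph \<Rightarrow> ('v \<Rightarrow> nat) \<Rightarrow> 'v set \<Rightarrow> ('v set \<Rightarrow> 'v graph \<times> ('v \<Rightarrow> nat)) \<Rightarrow>
   'v graph \<Rightarrow> ('v \<Rightarrow> nat) \<Rightarrow> bool" where
  "respects_char G LG S g H LH \<longleftrightarrow>
    (\<forall>B\<in>block_set G S. \<forall>X\<in>blocks (gsum G H). B \<subseteq> X \<longrightarrow>
        label_iso (induced (gsum G H) X, lsum G LG LH) (g B))"

datatype 'v auxnode = CompG "'v set" | CompH "'v set" | CompS "'v set"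

text \<open>Aux(G,S) (+) Aux(H,S): components of G, of H, and of G[S] = H[S] (shared).\<close>
definition aux_sum :: "'v graph \<Rightarrow> 'v graph \<Rightarrow> 'v set \<Rightarrow> 'v auxnode graph" where
  "aux_sum G H S =
    (CompG ` components G \<union> CompH ` components H \<union> CompS ` components (induced G S),
     {{CompG C1, CompS C2} | C1 C2. C1 \<in> components G \<and> C2 \<in> components (induced G S) \<and> C2 \<subseteq> C1}
     \<union> {{CompH C1, CompS C2} | C1 C2. C1 \<in> components H \<and> C2 \<in> components (induced H S) \<and> C2 \<subseteq> C1})"

definition has_cycle :: "'v graph \<Rightarrow> bool" where
  "has_cycle G \<longleftrightarrow> (\<exists>vs. length vs \<ge> 3 \<and> distinct vs \<and> set vs \<subseteq> verts G \<and>
     (\<forall>i<length vs. adj G (vs ! i) (vs ! ((i + 1) mod length vs))))"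

end

theory Submission
  imports Defs
begin

text \<open>Call an edge labelling with values in \<open>Z/2\<close> a cocycle if it sums to zero around every
  triangle, and call a graph acyclic2 if each cocycle is a coboundary. Graphs without holes have this
  property, and it survives gluing along a forest of components, so it holds for \<open>K = G2 + H\<close>
  and forces the link of a vertex in a block of \<open>K\<close> to be connected.

  Let \<open>X\<close> be a block of \<open>K\<close> containing \<open>B0\<close> of \<open>Block(G2,S)\<close>. Passing from triangle to triangle,
  every edge of \<open>X\<close> lies in a block of \<open>G2\<close> or \<open>H\<close> that the labels embed into \<open>g B0\<close>. The labelling
  maps the neighbourhood of each vertex of \<open>X\<close> isomorphically onto a neighbourhood in \<open>g B0\<close>: at a
  vertex incident with an edge inside \<open>S\<close> by applying the covering argument of the last step to its link, at the
  others by condition (d) or by comparison with \<open>G1 + H\<close>. Finally, a local isomorphism from a connected graph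
  to a connected graph without holes is an isomorphism, so \<open>X\<close> is label-isomorphic to \<open>g B0\<close>. A block
  of \<open>K\<close> with no edge inside \<open>S\<close> is a block of \<open>G2\<close> or of \<open>H\<close>.\<close>

text \<open>Chordality of \<open>K\<close> cannot be used on the way, since gluing along a forest
  does not preserve it: if \<open>S\<close> spans a path with three vertices and each side has one
  more vertex adjacent to all of \<open>S\<close>, the two extra vertices and the ends of the path
  form an induced 4-cycle. Such cycles are excluded only at the end, through the characteristic.
  What does survive the gluing is the vanishing of first cohomology, by a Mayer-Vietoris argument,
  and this suffices for connected links. Values in Z/2 make cochains Boolean and coverings
  two-sheeted. For the same reason the covering argument puts hole-freeness on the target, which in
  the comparison of blocks is a part of the chordal graph \<open>g B0\<close>. It is used at two
  levels because a vertex with an edge inside \<open>S\<close> may have neighbours in many blocks of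
  \<open>G2\<close> and of \<open>H\<close>. No single hypothesis describes its neighbourhood, but
  for each edge at the vertex the common neighbours of the two ends can be controlled. The tools
  speak of relations instead of graphs so that they serve links, double covers and relations between
  labels as well.\<close>

section \<open>Connectivity, holes and coverings of relations\<close>

definition within :: "('a \<Rightarrow> 'a \<Rightarrow> bool) \<Rightarrow> 'a set \<Rightarrow> 'a \<Rightarrow> 'a \<Rightarrow> bool" where
  "within r A x y \<longleftrightarrow> r x y \<and> x \<in> A \<and> y \<in> A"

text \<open>The empty set counts as connected. Deleting the only vertex of a singleton is then
  harmless, and \<open>bicon\<close> does without the cardinality guard of
  \<open>biconnected\<close>.\<close>

definition con :: "('a \<Rightarrow> 'a \<Rightarrow> bool) \<Rightarrow> 'a set \<Rightarrow> bool" where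
  "con r A \<longleftrightarrow> (\<forall>u\<in>A. \<forall>v\<in>A. (within r A)\<^sup>*\<^sup>* u v)"

definition bicon :: "('a \<Rightarrow> 'a \<Rightarrow> bool) \<Rightarrow> 'a set \<Rightarrow> bool" where
  "bicon r A \<longleftrightarrow> con r A \<and> (\<forall>v\<in>A. con r (A - {v}))"

definition link :: "('a \<Rightarrow> 'a \<Rightarrow> bool) \<Rightarrow> 'a \<Rightarrow> 'a \<Rightarrow> 'a \<Rightarrow> bool" where
  "link r w = within r {u. r w u}"

text \<open>Unlike in \<open>chordal\<close>, a hole is a cyclic sequence and not a vertex set:
  shortest walks produce it in this form, and injective maps carry it over.\<close>

definition hole_free :: "('a \<Rightarrow> 'a \<Rightarrow> bool) \<Rightarrow> bool" where
  "hole_free r \<longleftrightarrow> \<not> (\<exists>n c. n \<ge> 4 \<and> inj_on c {..<n} \<and>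
     (\<forall>i<n. \<forall>j<n. r (c i) (c j) \<longleftrightarrow>
        j = Suc i \<or> i = Suc j \<or> (i = 0 \<and> j = n - 1) \<or> (j = 0 \<and> i = n - 1)))"

lemma within_mono: "A \<subseteq> B \<Longrightarrow> (within r A)\<^sup>*\<^sup>* x y \<Longrightarrow> (within r B)\<^sup>*\<^sup>* x y"
  by (erule rtranclp_mono[THEN predicate2D, rotated]) (auto simp: within_def)

lemma rtranclp_subrel: "(\<And>x y. r x y \<Longrightarrow> s x y) \<Longrightarrow> r\<^sup>*\<^sup>* x y \<Longrightarrow> s\<^sup>*\<^sup>* x y"
  by (erule rtranclp_mono[THEN predicate2D, rotated]) auto

lemma rtranclp_sym: assumes "symp r" "r\<^sup>*\<^sup>* x y" shows "r\<^sup>*\<^sup>* y x"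
  using assms(2,1) by (induction rule: rtranclp_induct) (auto dest: sympD intro: converse_rtranclp_into_rtranclp)

lemma within_symp: "symp r \<Longrightarrow> symp (within r A)"
  by (auto simp: symp_def within_def)

lemma con_Un: "con r A \<Longrightarrow> con r B \<Longrightarrow> x \<in> A \<Longrightarrow> x \<in> B \<Longrightarrow> con r (A \<union> B)"
  unfolding con_def
proof (intro ballI)
  fix u v
  assume a: "\<forall>u\<in>A. \<forall>v\<in>A. (within r A)\<^sup>*\<^sup>* u v" and b: "\<forall>u\<in>B. \<forall>v\<in>B. (within r B)\<^sup>*\<^sup>* u v"
    and x: "x \<in> A" "x \<in> B" and u: "u \<in> A \<union> B" and v: "v \<in> A \<union> B"
  have "(within r (A \<union> B))\<^sup>*\<^sup>* u x" "(within r (A \<union> B))\<^sup>*\<^sup>* x v"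
    using a b x u v by (auto intro: within_mono[of A] within_mono[of B])
  then show "(within r (A \<union> B))\<^sup>*\<^sup>* u v" by (rule rtranclp_trans)
qed

text \<open>Whichever vertex is deleted, one of the two common vertices remains and joins the two
  sets.\<close>

lemma bicon_Un:
  assumes "bicon r A" "bicon r B" "x \<in> A" "x \<in> B" "y \<in> A" "y \<in> B" "x \<noteq> y"
  shows "bicon r (A \<union> B)"
proof -
  have m: "con r (C - {v})" if "bicon r C" for C v
    using that by (cases "v \<in> C") (auto simp: bicon_def)
  have "con r (A \<union> B - {v})" for v
  proof -
    obtain z where "z \<in> A - {v}" "z \<in> B - {v}" using assms by (cases "v = x") auto
    then show ?thesis using con_Un[OF m m, of A B z v v] assms by (simp add: Un_Diff)
  qed
  then show ?thesis using assms con_Un[of r A B x] by (auto simp: bicon_def)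
qed

lemma bicon_clique:
  assumes "\<And>x y. x \<in> A \<Longrightarrow> y \<in> A \<Longrightarrow> x \<noteq> y \<Longrightarrow> r x y"
  shows "bicon r A"
proof -
  have "con r C" if "C \<subseteq> A" for C
    unfolding con_def
  proof (intro ballI)
    fix u v assume "u \<in> C" "v \<in> C"
    then show "(within r C)\<^sup>*\<^sup>* u v"
      using assms[of u v] subsetD[OF that] by (cases "u = v") (auto simp: within_def intro!: r_into_rtranclp)
  qed
  then show ?thesis by (auto simp: bicon_def)
qed

text \<open>A shortest path whose distinct endpoints have the same image projects to a closed walk; a
  chord of it would lift to a shortcut, so the walk is a hole.\<close>
lemma cover_inj:
  assumes symr: "symp r" and irr: "\<And>x. \<not> s x x" and syms: "symp s" and hf: "hole_free s"
    and hom: "\<And>x y. r x y \<Longrightarrow> s (\<phi> x) (\<phi> y)"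
    and lift: "\<And>x x' b. r x x' \<Longrightarrow> s (\<phi> x) b \<Longrightarrow> \<exists>y. r x y \<and> \<phi> y = b"
    and inj: "\<And>x y z. r x y \<Longrightarrow> r x z \<Longrightarrow> \<phi> y = \<phi> z \<Longrightarrow> y = z"
    and refl: "\<And>x y z. r x y \<Longrightarrow> r x z \<Longrightarrow> s (\<phi> y) (\<phi> z) \<Longrightarrow> r y z"
    and xy: "r\<^sup>*\<^sup>* x y" "\<phi> x = \<phi> y"
  shows "x = y"
proof (rule ccontr)
  assume "x \<noteq> y"
  let ?P = "\<lambda>n. \<exists>x y. (r ^^ n) x y \<and> \<phi> x = \<phi> y \<and> x \<noteq> y"
  define n where "n = (LEAST n. ?P n)"
  have "\<exists>n. ?P n" using xy \<open>x \<noteq> y\<close> rtranclp_imp_relpowp by metis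
  then have "?P n" unfolding n_def by (rule LeastI_ex)
  have min: "a = b" if "m < n" "(r ^^ m) a b" "\<phi> a = \<phi> b" for m a b
    using not_less_Least[of m ?P] that unfolding n_def by blast
  obtain f where f: "\<forall>i<n. r (f i) (f (Suc i))" "\<phi> (f 0) = \<phi> (f n)" "f 0 \<noteq> f n"
    using \<open>?P n\<close> relpowp_fun_conv by metis
  have seg: "(r ^^ (j - i)) (f i) (f j)" if "i \<le> j" "j \<le> n" for i j
    unfolding relpowp_fun_conv by (rule exI[of _ "\<lambda>k. f (i + k)"]) (use f that in auto)
  \<comment> \<open>A shortcut between two points of the walk would yield a shorter walk from
    \<open>f 0\<close> to \<open>f n\<close>, which minimality makes closed, against
    \<open>f 0 \<noteq> f n\<close>.\<close>
  have cut: False if "(r ^^ m) (f i) (f j)" "i \<le> n" "j \<le> n" "m < j - i" for m i j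
  proof -
    have "(r ^^ (i + (m + (n - j)))) (f 0) (f n)"
      unfolding relpowp_add using seg[of 0 i] seg[of j n] that by (auto intro!: relcomppI)
    then show False using min[of "i + (m + (n - j))"] that f by auto
  qed
  have dist: "\<phi> (f i) \<noteq> \<phi> (f j)" if "i < j" "j < n" for i j
  proof
    assume "\<phi> (f i) = \<phi> (f j)"
    then have "f i = f j" using min[OF _ seg, of j i] that by auto
    then have "(r ^^ 0) (f i) (f j)" by simp
    then show False using cut[of 0 i j] that by auto
  qed
  have n1: "n > 1"
  proof (rule ccontr)
    assume "\<not> n > 1"
    then have "n = 0 \<or> n = 1" by auto
    then show False using f hom[of "f 0" "f 1"] irr by auto
  qed
  have n2: "n \<noteq> 2" using f inj[of "f 1" "f 0" "f 2"] symr by (auto simp: numeral_2_eq_2 dest: sympD)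
  \<comment> \<open>Over a triangle, \<open>refl\<close> at \<open>f 1\<close> makes
    \<open>f 0\<close> a neighbour of \<open>f 2\<close>; then \<open>f 0\<close> and
    \<open>f 3\<close> are neighbours of \<open>f 2\<close> with the same image.\<close>
  have n3: "n \<noteq> 3"
  proof
    assume n: "n = 3"
    have e: "r (f 0) (f 1)" "r (f 1) (f 2)" "r (f 2) (f 3)"
      using f(1) n by (auto simp: numeral_2_eq_2 numeral_3_eq_3)
    then have "r (f 0) (f 2)"
      using refl[of "f 1" "f 0" "f 2"] hom[of "f 2" "f 3"] f n syms symr by (metis sympD)
    then show False using inj[of "f 2" "f 0" "f 3"] f e n symr by (metis sympD)
  qed
  have n4: "n \<ge> 4" using n1 n2 n3 by linarith
  have chord: "j = Suc i \<or> (i = 0 \<and> j = n - 1)" if ij: "i < j" "j < n" and s: "s (\<phi> (f i)) (\<phi> (f j))" for i j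
  proof (rule ccontr)
    assume c: "\<not> ?thesis"
    obtain y where y: "r (f i) y" "\<phi> y = \<phi> (f j)"
      using lift[of "f i" "f (Suc i)"] f(1) ij s by (meson order_less_trans)
    have "(r ^^ (1 + (j - i))) y (f j)"
      unfolding relpowp_add using y symr seg[of i j] ij by (auto dest: sympD)
    moreover have "1 + (j - i) < n" using c ij by auto
    ultimately have "y = f j" using min y by blast
    then have "(r ^^ 1) (f i) (f j)" using y unfolding relpowp_1 by simp
    then show False using cut[of 1 i j] c ij by force
  qed
  have wrap: "s (\<phi> (f 0)) (\<phi> (f (n - 1)))"
    using hom[of "f (n-1)" "f n"] f(1)[rule_format, of "n - 1"] f(2) n4 syms by (auto dest: sympD)
  have "inj_on (\<phi> \<circ> f) {..<n}"
    by (rule linorder_inj_onI) (use dist in \<open>auto simp: comp_def\<close>)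
  moreover have "s ((\<phi> \<circ> f) i) ((\<phi> \<circ> f) j) \<longleftrightarrow>
        j = Suc i \<or> i = Suc j \<or> (i = 0 \<and> j = n - 1) \<or> (j = 0 \<and> i = n - 1)" (is "?l \<longleftrightarrow> ?r")
    if ij: "i < n" "j < n" for i j
  proof
    assume l: ?l
    then have l': "s (\<phi> (f i)) (\<phi> (f j))" "s (\<phi> (f j)) (\<phi> (f i))" using syms by (auto dest: sympD)
    consider "i = j" | "i < j" | "j < i" by linarith
    then show ?r using l' irr chord[of i j] chord[of j i] ij by cases auto
  next
    assume ?r
    then show ?l using wrap hom f(1) ij syms by (auto dest: sympD)
  qed
  ultimately show False using hf n4 unfolding hole_free_def by blast
qed

section \<open>Cocycles modulo two and connected links\<close>

definition cocycle :: "('a \<Rightarrow> 'a \<Rightarrow> bool) \<Rightarrow> ('a \<Rightarrow> 'a \<Rightarrow> bool) \<Rightarrow> bool" where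
  "cocycle r f \<longleftrightarrow> (\<forall>x y. r x y \<longrightarrow> f x y = f y x) \<and>
     (\<forall>x y z. r x y \<longrightarrow> r y z \<longrightarrow> r x z \<longrightarrow> (f x z \<longleftrightarrow> f x y \<noteq> f y z))"

definition potential :: "('a \<Rightarrow> 'a \<Rightarrow> bool) \<Rightarrow> ('a \<Rightarrow> 'a \<Rightarrow> bool) \<Rightarrow> ('a \<Rightarrow> bool) \<Rightarrow> bool" where
  "potential r f p \<longleftrightarrow> (\<forall>x y. r x y \<longrightarrow> (f x y \<longleftrightarrow> p x \<noteq> p y))"

definition acyclic2 :: "('a \<Rightarrow> 'a \<Rightarrow> bool) \<Rightarrow> bool" where
  "acyclic2 r \<longleftrightarrow> (\<forall>f. cocycle r f \<longrightarrow> (\<exists>p. potential r f p))"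

text \<open>A cocycle defines a double cover of the graph, which is trivial by \<open>cover_inj\<close>.\<close>
lemma hole_free_acyclic2:
  assumes symr: "symp r" and irr: "\<And>x. \<not> r x x" and hf: "hole_free r"
  shows "acyclic2 r"
  unfolding acyclic2_def
proof (intro allI impI)
  fix f assume f: "cocycle r f"
  \<comment> \<open>The double cover: an edge changes the sheet exactly where \<open>f\<close>
    holds. The cocycle condition lets triangles lift, which is the premise \<open>refl\<close> of
    \<open>cover_inj\<close>.\<close>
  define R :: "'a \<times> bool \<Rightarrow> 'a \<times> bool \<Rightarrow> bool" where "R = (\<lambda>(x, b) (y, c). r x y \<and> (f x y \<longleftrightarrow> b \<noteq> c))"
  have tri: "f x z \<longleftrightarrow> f x y \<noteq> f y z" if "r x y" "r y z" "r x z" for x y z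
    using f that unfolding cocycle_def by blast
  have fs: "f x y = f y x" if "r x y" for x y
    using f that unfolding cocycle_def by blast
  have symR: "symp R" using symr f by (auto simp: symp_def R_def cocycle_def)
  have uniq: "b = c" if "R\<^sup>*\<^sup>* (x, b) (x, c)" for x b c
  proof -
    have "(x, b) = (x, c)"
    proof (rule cover_inj[where r = R and s = r and \<phi> = fst])
      fix X X' :: "'a \<times> bool" and B assume "R X X'" "r (fst X) B"
      then show "\<exists>Y. R X Y \<and> fst Y = B"
        by (intro exI[of _ "(B, snd X \<noteq> f (fst X) B)"]) (auto simp: R_def split: prod.splits)
    next
      fix X Y Z assume a: "R X Y" "R X Z" "r (fst Y) (fst Z)"
      then have "r (fst Y) (fst X)" "r (fst X) (fst Z)" 
        using sympD[OF symr] by (simp_all add: R_def split_beta)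
      then have "f (fst Y) (fst Z) \<longleftrightarrow> f (fst Y) (fst X) \<noteq> f (fst X) (fst Z)"
        "f (fst Y) (fst X) = f (fst X) (fst Y)"
        using tri[of "fst Y" "fst X" "fst Z"] fs[of "fst Y" "fst X"] a(3) by simp_all
      then show "R Y Z" using a by (auto simp: R_def split: prod.splits)
    qed (use assms symR that in \<open>auto simp: R_def\<close>)
    then show ?thesis by simp
  qed
  \<comment> \<open>Base points: along an edge the predicates \<open>r\<^sup>*\<^sup>* x\<close>
    coincide, so \<open>SOME\<close> picks the same vertex throughout a component.\<close>
  define \<rho> where "\<rho> x = (SOME z. r\<^sup>*\<^sup>* x z)" for x
  have \<rho>1: "r\<^sup>*\<^sup>* (\<rho> x) x" for x
    using someI[of "r\<^sup>*\<^sup>* x" x] rtranclp_sym[OF symr] unfolding \<rho>_def by blast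
  have \<rho>2: "\<rho> x = \<rho> y" if "r x y" for x y
  proof -
    have "r\<^sup>*\<^sup>* x = r\<^sup>*\<^sup>* y"
      using that symr by (intro ext iffI) (meson converse_rtranclp_into_rtranclp sympD)+
    then show ?thesis by (simp add: \<rho>_def)
  qed
  \<comment> \<open>The sheet over \<open>x\<close> reached from the sheet \<open>False\<close> over
    the base point; some sheet is reached by \<open>ex\<close>, and only one by
    \<open>un\<close>.\<close>
  define p where "p x = R\<^sup>*\<^sup>* (\<rho> x, False) (x, True)" for x
  have ex: "\<exists>b. R\<^sup>*\<^sup>* (z, False) (x, b)" if "r\<^sup>*\<^sup>* z x" for z x
    using that
  proof induction
    case (step y x)
    then obtain b where "R\<^sup>*\<^sup>* (z, False) (y, b)" by blast
    moreover have "R (y, b) (x, b \<noteq> f y x)" using step by (auto simp: R_def)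
    ultimately show ?case by (meson rtranclp.rtrancl_into_rtrancl)
  qed auto
  have un: "b = c" if "R\<^sup>*\<^sup>* (z, False) (x, b)" "R\<^sup>*\<^sup>* (z, False) (x, c)" for z x b c
    using uniq rtranclp_sym[OF symR that(1)] that(2) by (meson rtranclp_trans)
  have pb: "p x = b" if "R\<^sup>*\<^sup>* (\<rho> x, False) (x, b)" for x b
    using that un[OF that] unfolding p_def by (cases b) auto
  have "f x y \<longleftrightarrow> p x \<noteq> p y" if xy: "r x y" for x y
  proof -
    obtain b where b: "R\<^sup>*\<^sup>* (\<rho> x, False) (x, b)" using ex[OF \<rho>1] by blast
    moreover have "R (x, b) (y, b \<noteq> f x y)" using xy by (auto simp: R_def)
    ultimately have "R\<^sup>*\<^sup>* (\<rho> y, False) (y, b \<noteq> f x y)"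
      using \<rho>2[OF xy] by (metis rtranclp.rtrancl_into_rtrancl)
    then show ?thesis using pb b by auto
  qed
  then show "\<exists>p. potential r f p" unfolding potential_def by blast
qed

text \<open>The cocycle is the indicator of the edges from \<open>w\<close> to one component of its link.\<close>
lemma link_connected:
  assumes symr: "symp r" and irr: "\<And>x. \<not> r x x" and ac: "acyclic2 r"
    and wa: "r w a" and wb: "r w b" and ab: "(within r (- {w}))\<^sup>*\<^sup>* a b"
  shows "(link r w)\<^sup>*\<^sup>* a b"
proof -
  define A where "A = {x. (link r w)\<^sup>*\<^sup>* a x}"
  define f where "f x y \<longleftrightarrow> (x = w \<and> y \<in> A) \<or> (y = w \<and> x \<in> A)" for x y
  have sl: "symp (link r w)" unfolding link_def using within_symp[OF symr] .
  \<comment> \<open>A triangle at \<open>w\<close> has both or none of its other corners in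
    \<open>A\<close>; this gives the cocycle condition.\<close>
  have A: "x \<in> A \<longleftrightarrow> y \<in> A" if "r w x" "r w y" "r x y" for x y
  proof -
    have "link r w x y" using that by (auto simp: link_def within_def)
    then have "link r w x y" "link r w y x" using sl by (auto dest: sympD)
    then show ?thesis unfolding A_def mem_Collect_eq by (meson rtranclp.rtrancl_into_rtrancl)
  qed
  have Aw: "r w x" if "x \<in> A" for x
    using that wa unfolding A_def mem_Collect_eq
    by (induction rule: rtranclp_induct) (auto simp: link_def within_def)
  have "cocycle r f"
    unfolding cocycle_def
  proof (intro conjI allI impI)
    fix x y z assume xyz: "r x y" "r y z" "r x z"
    then have d: "x \<noteq> y" "y \<noteq> z" "x \<noteq> z" and "r y x" "r z y" "r z x"
      using irr symr by (auto dest: sympD)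
    then show "f x z \<longleftrightarrow> f x y \<noteq> f y z"
      using A[of x y] A[of y z] A[of x z] xyz unfolding f_def by metis
  qed (auto simp: f_def)
  then obtain p :: "'a \<Rightarrow> bool" where p: "\<And>x y. r x y \<Longrightarrow> (f x y \<longleftrightarrow> p x \<noteq> p y)"
    using ac unfolding acyclic2_def potential_def by blast
  \<comment> \<open>Away from \<open>w\<close> the cocycle vanishes, so \<open>p\<close> is constant
    along the walk from \<open>a\<close> to \<open>b\<close>, and \<open>f w b\<close> agrees with
    \<open>f w a\<close>.\<close>
  have "p a = p b"
    using ab
  proof induction
    case (step y z)
    then show ?case using p[of y z] by (auto simp: within_def f_def)
  qed auto
  moreover have "a \<in> A" by (simp add: A_def)
  ultimately have "f w b" using p wa wb unfolding f_def by blast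
  then have "b \<in> A" using Aw irr unfolding f_def by blast
  then show ?thesis by (simp add: A_def)
qed

text \<open>Take the step by which the walk leaves \<open>w\<close> for the last time; a return to
  \<open>w\<close> restarts the choice of \<open>u\<close>.\<close>

lemma rtranclp_first_step:
  assumes "r\<^sup>*\<^sup>* w x" "w \<noteq> x"
  shows "\<exists>u. r w u \<and> (within r (- {w}))\<^sup>*\<^sup>* u x"
  using assms
proof (induction rule: rtranclp_induct)
  case (step y z)
  show ?case
  proof (cases "y = w")
    case True
    then show ?thesis using step by blast
  next
    case False
    then obtain u where "r w u" "(within r (- {w}))\<^sup>*\<^sup>* u y" using step by blast
    moreover have "within r (- {w}) y z" using step False by (simp add: within_def)
    ultimately show ?thesis by (meson rtranclp.rtrancl_into_rtrancl)
  qed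
qed auto

section \<open>Potentials on forests\<close>

text \<open>A longest path cannot be extended at its head, so a neighbour of the head other than the
  second vertex lies on the path and closes a cycle.\<close>

lemma min_degree_two_cycle:
  assumes fin: "finite V" and ne: "V \<noteq> {}" and symr: "symp r" and irr: "\<And>x. \<not> r x x"
    and deg: "\<And>v. v \<in> V \<Longrightarrow> \<exists>a\<in>V. \<exists>b\<in>V. a \<noteq> b \<and> r v a \<and> r v b"
  shows "\<exists>vs. length vs \<ge> 3 \<and> distinct vs \<and> set vs \<subseteq> V \<and>
     (\<forall>i<length vs. r (vs ! i) (vs ! ((i + 1) mod length vs)))"
proof -
  define PP where "PP xs \<longleftrightarrow> xs \<noteq> [] \<and> distinct xs \<and> set xs \<subseteq> V \<and>
    (\<forall>i. Suc i < length xs \<longrightarrow> r (xs ! i) (xs ! Suc i))" for xs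
  obtain v where "v \<in> V" using ne by blast
  then have "PP [v]" by (auto simp: PP_def)
  moreover have "\<forall>xs. PP xs \<longrightarrow> length xs < Suc (card V)"
    using fin by (metis PP_def card_mono distinct_card less_Suc_eq_le)
  ultimately obtain xs where xs: "PP xs" and mx: "\<And>ys. PP ys \<Longrightarrow> length ys \<le> length xs"
    using ex_has_greatest_nat[of PP "[v]" length "Suc (card V)"] by blast
  have "hd xs \<in> V" using xs by (auto simp: PP_def)
  from deg[OF this] obtain a b where ab: "a \<in> V" "b \<in> V" "a \<noteq> b" "r (hd xs) a" "r (hd xs) b"
    by blast
  obtain c where c: "c \<in> V" "r (hd xs) c" "length xs > 1 \<Longrightarrow> c \<noteq> xs ! 1" using ab by metis
  have "\<not> PP (c # xs)" using mx[of "c # xs"] by auto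
  moreover have "r ((c # xs) ! i) ((c # xs) ! Suc i)" if "Suc i < length (c # xs)" for i
    using that xs c symr by (cases i) (auto simp: PP_def hd_conv_nth dest: sympD)
  ultimately have "c \<in> set xs" using xs c by (auto simp: PP_def)
  then obtain k where k: "k < length xs" "c = xs ! k" by (auto simp: in_set_conv_nth)
  have "k \<noteq> 0"
  proof
    assume "k = 0"
    then show False using c(2) k irr[of "hd xs"] xs by (simp add: PP_def hd_conv_nth)
  qed
  moreover have "k \<noteq> 1" using c k by auto
  ultimately have k2: "k \<ge> 2" by auto
  let ?vs = "take (Suc k) xs"
  have len: "length ?vs = Suc k" using k by simp
  have "r (?vs ! i) (?vs ! ((i + 1) mod length ?vs))" if "i < length ?vs" for i
  proof (cases "i = k")
    case True
    then have "?vs ! ((i + 1) mod length ?vs) = hd xs" using len xs by (simp add: PP_def hd_conv_nth)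
    then show ?thesis using True c(2) k symr by (auto dest: sympD)
  next
    case False
    then have "Suc i < Suc k" using that len by auto
    then show ?thesis using len xs k by (simp add: PP_def)
  qed
  then show ?thesis
    using k2 len xs by (intro exI[of _ ?vs]) (auto simp: PP_def dest: in_set_takeD)
qed

text \<open>Delete a vertex with at most one neighbour, which exists by
  \<open>min_degree_two_cycle\<close>; its value can be chosen afterwards to suit its only
  edge.\<close>

lemma forest_potential:
  assumes fin: "finite V" and symr: "symp r" and irr: "\<And>x. \<not> r x x"
    and symc: "\<And>x y. r x y \<Longrightarrow> c x y = c y x"
    and nc: "\<not> (\<exists>vs. length vs \<ge> 3 \<and> distinct vs \<and> set vs \<subseteq> V \<and>
     (\<forall>i<length vs. r (vs ! i) (vs ! ((i + 1) mod length vs))))"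
  shows "\<exists>p. potential (within r V) c p"
  using fin nc
proof (induction "card V" arbitrary: V)
  case 0
  then show ?case by (auto simp: potential_def within_def)
next
  case (Suc n)
  then have "V \<noteq> {}" by auto
  then obtain v where v: "v \<in> V" "\<not> (\<exists>a\<in>V. \<exists>b\<in>V. a \<noteq> b \<and> r v a \<and> r v b)"
    using min_degree_two_cycle[OF Suc.prems(1) _ symr irr] Suc.prems(2) by blast
  have "\<exists>p. potential (within r (V - {v})) c p"
  proof (rule Suc.hyps(1))
    show "\<not> (\<exists>vs. length vs \<ge> 3 \<and> distinct vs \<and> set vs \<subseteq> V - {v} \<and>
     (\<forall>i<length vs. r (vs ! i) (vs ! ((i + 1) mod length vs))))"
      using Suc.prems(2) by (meson Diff_subset subset_trans)
  qed (use Suc v in auto)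
  then obtain p where p: "potential (within r (V - {v})) c p" ..
  \<comment> \<open>For the only neighbour \<open>a\<close> of \<open>v\<close>, the new value
    differs from \<open>p a\<close> exactly when \<open>c v a\<close> holds. An isolated
    \<open>v\<close> gets the default \<open>False\<close>.\<close>
  define q where "q = p(v := (\<exists>a\<in>V. r v a \<and> c v a \<noteq> p a))"
  have qv: "c v a \<longleftrightarrow> q v \<noteq> q a" if a: "a \<in> V" "r v a" for a
  proof -
    have "a \<noteq> v" using irr a by auto
    moreover have "(\<exists>a\<in>V. r v a \<and> c v a \<noteq> p a) \<longleftrightarrow> c v a \<noteq> p a" using v(2) a by metis
    ultimately show ?thesis by (auto simp: q_def)
  qed
  have "c x y \<longleftrightarrow> q x \<noteq> q y" if xy: "within r V x y" for x y
  proof -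
    consider "x = v" | "y = v" "x \<noteq> v" | "x \<noteq> v" "y \<noteq> v" by auto
    then show ?thesis
    proof cases
      case 1
      then show ?thesis using qv xy by (auto simp: within_def)
    next
      case 2
      then show ?thesis using qv[of x] xy symc[of x y] symr by (auto simp: within_def dest: sympD)
    next
      case 3
      then show ?thesis using p xy by (auto simp: q_def within_def potential_def)
    qed
  qed
  then show ?case unfolding potential_def by blast
qed

section \<open>Graphs, blocks and components\<close>

lemma adj_sym: "adj G u v \<Longrightarrow> adj G v u"
  by (auto simp: adj_def insert_commute)

lemma symp_adj: "symp (adj G)"
  by (auto simp: symp_def adj_sym)

lemma adj_irrefl [simp]: "\<not> adj G u u"
  by (simp add: adj_def)

lemma adj_verts:
  assumes "wf_graph G" "adj G u v"
  shows "u \<in> verts G" "v \<in> verts G"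
  using assms by (auto simp: wf_graph_def adj_def doubleton_eq_iff)

lemma finite_verts: "wf_graph G \<Longrightarrow> finite (verts G)"
  by (simp add: wf_graph_def)

lemma verts_induced: "verts (induced G A) = verts G \<inter> A"
  by (simp add: verts_def induced_def)

lemma adj_induced: "adj (induced G A) = within (adj G) A"
  by (intro ext) (auto simp: adj_def within_def induced_def edges_def)

lemma within_within: "within (within r A) B = within r (A \<inter> B)"
  by (intro ext) (auto simp: within_def)

lemma connected_induced:
  "A \<subseteq> verts G \<Longrightarrow> connected (induced G A) \<longleftrightarrow> A \<noteq> {} \<and> con (adj G) A"
  by (auto simp: connected_def con_def verts_induced adj_induced Int_absorb1)

text \<open>From two vertices on, deleting one leaves a nonempty set; for a single vertex both
  notions reduce to connectedness.\<close>

lemma biconnected_induced: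
  assumes "wf_graph G" "A \<subseteq> verts G"
  shows "biconnected (induced G A) \<longleftrightarrow> A \<noteq> {} \<and> bicon (adj G) A"
proof (cases "A = {}")
  case True
  then show ?thesis using connected_induced[of A G] assms by (simp add: biconnected_def)
next
  case False
  have fin: "finite A" using assms finite_verts finite_subset by blast
  have v: "verts (induced G A) = A" using assms by (simp add: verts_induced Int_absorb1)
  have c: "connected (induced (induced G A) (A - {v})) \<longleftrightarrow> A - {v} \<noteq> {} \<and> con (adj G) (A - {v})" for v
    using connected_induced[of "A - {v}" "induced G A"] v
    by (simp add: con_def adj_induced within_within Int_absorb1 Diff_subset)
  show ?thesis
  proof (cases "card A \<ge> 2")
    case True
    have "A - {v} \<noteq> {}" for v
    proof
      assume "A - {v} = {}"
      then have "A \<subseteq> {v}" by blast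
      then have "card A \<le> 1" using card_mono[of "{v}" A] by simp
      then show False using True by simp
    qed
    then show ?thesis
      using False True c connected_induced[OF assms(2)] by (simp add: biconnected_def bicon_def v)
  next
    case c1: False
    then have "card A = 1" using False fin by (metis One_nat_def Suc_1 card_0_eq le_Suc_eq not_less_eq_eq le_0_eq nat_le_linear)
    then obtain a where a: "A = {a}" by (auto simp: card_1_singleton_iff)
    have "biconnected (induced G A) \<longleftrightarrow> connected (induced G A)"
      using c1 by (simp add: biconnected_def v)
    then show ?thesis
      using connected_induced[OF assms(2)] by (simp add: bicon_def con_def a)
  qed
qed

lemma blocks_iff:
  assumes "wf_graph G"
  shows "X \<in> blocks G \<longleftrightarrow> X \<subseteq> verts G \<and> X \<noteq> {} \<and> bicon (adj G) X \<and>
    (\<forall>X'. X \<subseteq> X' \<longrightarrow> X' \<subseteq> verts G \<longrightarrow> bicon (adj G) X' \<longrightarrow> X' = X)"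
  using biconnected_induced[OF assms] unfolding blocks_def by blast

lemma
  assumes "wf_graph G" "X \<in> blocks G"
  shows block_verts: "X \<subseteq> verts G" and block_nonempty: "X \<noteq> {}" and block_bicon: "bicon (adj G) X"
    and block_maximal: "X \<subseteq> X' \<Longrightarrow> X' \<subseteq> verts G \<Longrightarrow> bicon (adj G) X' \<Longrightarrow> X' = X"
  using assms by (simp_all add: blocks_iff)

text \<open>The union is biconnected by \<open>bicon_Un\<close>, so maximality of \<open>X\<close>
  swallows \<open>A\<close>. Mostly \<open>x\<close> and \<open>y\<close> will be the ends of an
  edge.\<close>

lemma block_absorb:
  assumes "wf_graph G" "X \<in> blocks G" "A \<subseteq> verts G" "bicon (adj G) A"
    and "x \<in> X" "x \<in> A" "y \<in> X" "y \<in> A" "x \<noteq> y"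
  shows "A \<subseteq> X"
proof -
  have "bicon (adj G) (X \<union> A)"
    using bicon_Un[OF block_bicon[OF assms(1,2)] assms(4,5,6,7,8,9)] .
  then have "X \<union> A = X"
    using block_maximal[OF assms(1,2) Un_upper1[of X A]] assms(3) block_verts[OF assms(1,2)] by simp
  then show ?thesis by blast
qed

lemma bicon_in_block:
  assumes "wf_graph G" "A \<subseteq> verts G" "A \<noteq> {}" "bicon (adj G) A"
  shows "\<exists>X\<in>blocks G. A \<subseteq> X"
proof -
  let ?F = "{X. A \<subseteq> X \<and> X \<subseteq> verts G \<and> bicon (adj G) X}"
  have "finite ?F" using finite_verts[OF assms(1)] by (auto intro: finite_subset[of _ "Pow (verts G)"])
  moreover have "A \<in> ?F" using assms by simp
  ultimately obtain X where "X \<in> ?F" "\<forall>Y\<in>?F. X \<subseteq> Y \<longrightarrow> X = Y"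
    using finite_has_maximal[of ?F] by blast
  moreover have "A \<subseteq> X" "X \<noteq> {}" using assms(3) calculation by auto
  ultimately have "X \<in> blocks G" "A \<subseteq> X" unfolding blocks_iff[OF assms(1)]
    by (simp_all, metis subset_trans)
  then show ?thesis by blast
qed

lemma bicon_edge: "adj G x y \<Longrightarrow> bicon (adj G) {x, y}"
  by (rule bicon_clique) (auto dest: adj_sym)

lemma edge_in_block:
  assumes "wf_graph G" "adj G x y"
  obtains X where "X \<in> blocks G" "x \<in> X" "y \<in> X"
  using bicon_in_block[OF assms(1) _ _ bicon_edge[OF assms(2)]] adj_verts[OF assms] by auto

lemma block_triangle:
  assumes "wf_graph G" "X \<in> blocks G" "x \<in> X" "y \<in> X" "adj G x y" "adj G y z" "adj G x z"
  shows "z \<in> X"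
proof -
  have "bicon (adj G) {x, y, z}" by (rule bicon_clique) (use assms in \<open>auto dest: adj_sym\<close>)
  moreover have "{x, y, z} \<subseteq> verts G" "x \<noteq> y"
    using assms(5) adj_verts[OF assms(1,5)] adj_verts[OF assms(1,6)] by auto
  ultimately have "{x, y, z} \<subseteq> X" using block_absorb[OF assms(1,2), of "{x, y, z}" x y] assms by simp
  then show ?thesis by simp
qed

lemma block_neighbour:
  assumes "wf_graph G" "X \<in> blocks G" "x \<in> X" "y \<in> X" "x \<noteq> y"
  shows "\<exists>z\<in>X. adj G x z"
proof -
  have "(within (adj G) X)\<^sup>*\<^sup>* x y" using assms by (auto simp: blocks_iff bicon_def con_def)
  from rtranclp_first_step[OF this assms(5)] show ?thesis by (auto simp: within_def)
qed

text \<open>A cycle without one vertex is a path: any two remaining vertices are joined by the arc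
  between them that avoids the deleted one, possibly over the closing edge from \<open>0\<close> to
  \<open>n - 1\<close>.\<close>

lemma hole_bicon:
  assumes n: "n \<ge> (4::nat)" and c: "inj_on c {..<n}"
    and r: "\<And>i j. i < n \<Longrightarrow> j < n \<Longrightarrow> r (c i) (c j) \<longleftrightarrow>
        j = Suc i \<or> i = Suc j \<or> (i = 0 \<and> j = n - 1) \<or> (j = 0 \<and> i = n - 1)"
  shows "bicon r (c ` {..<n})"
proof -
  have up: "(within r D)\<^sup>*\<^sup>* (c i) (c j)" and down: "(within r D)\<^sup>*\<^sup>* (c j) (c i)"
    if "i \<le> j" "j < n" "c ` {i..j} \<subseteq> D" for i j D
  proof -
    have "(within r D)\<^sup>*\<^sup>* (c i) (c j) \<and> (within r D)\<^sup>*\<^sup>* (c j) (c i)"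
      using that
    proof (induction j rule: dec_induct)
      case (step j)
      have "within r D (c j) (c (Suc j))" "within r D (c (Suc j)) (c j)"
        using step r[of j "Suc j"] r[of "Suc j" j] by (auto simp: within_def)
      moreover have "c ` {i..j} \<subseteq> D" using step by auto
      ultimately show ?case
        using step.IH step.prems by (meson Suc_lessD converse_rtranclp_into_rtranclp rtranclp.rtrancl_into_rtrancl)
    qed auto
    then show "(within r D)\<^sup>*\<^sup>* (c i) (c j)" "(within r D)\<^sup>*\<^sup>* (c j) (c i)" by auto
  qed
  have wrap: "within r D (c 0) (c (n - 1))" "within r D (c (n - 1)) (c 0)"
    if "c 0 \<in> D" "c (n - 1) \<in> D" for D
    using that r[of 0 "n - 1"] r[of "n - 1" 0] n by (auto simp: within_def)
  have key: "(within r (c ` {..<n} - {c k}))\<^sup>*\<^sup>* (c i) (c j) \<and> (within r (c ` {..<n} - {c k}))\<^sup>*\<^sup>* (c j) (c i)"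
    if ij: "i \<le> j" "j < n" "i \<noteq> k" "j \<noteq> k" and k: "k < n" for i j k
  proof -
    let ?D = "c ` {..<n} - {c k}"
    have sub: "c ` {a..b} \<subseteq> ?D" if "b < n" "k \<notin> {a..b}" for a b
    proof
      fix v assume "v \<in> c ` {a..b}"
      then obtain i where "v = c i" "i \<in> {a..b}" by blast
      moreover have "i \<noteq> k" "i < n" using calculation that by auto
      ultimately show "v \<in> ?D" using c k by (auto simp: inj_on_eq_iff)
    qed
    show ?thesis
    proof (cases "k \<in> {i..j}")
      case False
      then show ?thesis using up[OF ij(1,2)] down[OF ij(1,2)] sub[OF ij(2)] by simp
    next
      case True
      have a: "c ` {0..i} \<subseteq> ?D" "c ` {j..n-1} \<subseteq> ?D" 
        using sub[of i 0] sub[of "n - 1" j] True ij n by auto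
      have 1: "(within r ?D)\<^sup>*\<^sup>* (c i) (c 0)" "(within r ?D)\<^sup>*\<^sup>* (c 0) (c i)"
        using up[of 0 i ?D] down[of 0 i ?D] a ij by auto
      have 2: "(within r ?D)\<^sup>*\<^sup>* (c j) (c (n - 1))" "(within r ?D)\<^sup>*\<^sup>* (c (n - 1)) (c j)"
        using up[of j "n - 1" ?D] down[of j "n - 1" ?D] a ij n by auto
      have "c 0 \<in> c ` {0..i}" "c (n - 1) \<in> c ` {j..n - 1}" using ij n by auto
      then have 3: "within r ?D (c 0) (c (n - 1))" "within r ?D (c (n - 1)) (c 0)"
        using wrap[of ?D] subsetD[OF a(1)] subsetD[OF a(2)] by blast+
      show ?thesis
        using rtranclp_trans[OF rtranclp.rtrancl_into_rtrancl[OF 1(1) 3(1)] 2(2)]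
          rtranclp_trans[OF rtranclp.rtrancl_into_rtrancl[OF 2(1) 3(2)] 1(2)] by blast
    qed
  qed
  have "(within r (c ` {..<n}))\<^sup>*\<^sup>* u v" if uv: "u \<in> c ` {..<n}" "v \<in> c ` {..<n}" for u v
  proof -
    obtain i j where ij: "u = c i" "v = c j" "i < n" "j < n" using uv by auto
    then have "c ` {i..j} \<subseteq> c ` {..<n}" "c ` {j..i} \<subseteq> c ` {..<n}" by (auto intro!: image_mono)
    note ij = ij this
    show ?thesis
    proof (cases "i \<le> j")
      case True
      then show ?thesis using up[of i j "c ` {..<n}"] ij by simp
    next
      case False
      then show ?thesis using down[of j i "c ` {..<n}"] ij by simp
    qed
  qed
  moreover have "con r (c ` {..<n} - {w})" if w: "w \<in> c ` {..<n}" for w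
    unfolding con_def
  proof (intro ballI)
    fix u v assume uv: "u \<in> c ` {..<n} - {w}" "v \<in> c ` {..<n} - {w}"
    then obtain i j k where "u = c i" "v = c j" "w = c k" "i < n" "j < n" "k < n" "i \<noteq> k" "j \<noteq> k"
      using w by auto
    then show "(within r (c ` {..<n} - {w}))\<^sup>*\<^sup>* u v"
      using key[of i j k] key[of j i k] by (cases "i \<le> j") auto
  qed
  ultimately show ?thesis by (simp add: bicon_def con_def)
qed

text \<open>Only the blocks of \<open>G\<close> are known to be chordal. But a hole is biconnected,
  hence lies in one block.\<close>

lemma P_block_graph_hole_free:
  assumes G: "P_block_graph P G" and P: "\<forall>G\<in>P. chordal G"
  shows "hole_free (adj G)"
  unfolding hole_free_def
proof (rule notI, elim exE conjE)
  fix n c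
  assume n: "n \<ge> (4::nat)" and c: "inj_on c {..<n}"
    and r: "\<forall>i<n. \<forall>j<n. adj G (c i) (c j) \<longleftrightarrow>
        j = Suc i \<or> i = Suc j \<or> (i = 0 \<and> j = n - 1) \<or> (j = 0 \<and> i = n - 1)"
  let ?C = "c ` {..<n}"
  have wf: "wf_graph G" using G by (simp add: P_block_graph_def)
  have bi: "bicon (adj G) ?C" using hole_bicon[OF n c] r by blast
  \<comment> \<open>Cyclic successor and predecessor. They differ since \<open>n \<ge> 4\<close>,
    and so give each vertex of the hole the degree two that \<open>chordal\<close> speaks
    of.\<close>
  define s where "s i = (if i = n - 1 then 0 else Suc i)" for i
  define p where "p i = (if i = 0 then n - 1 else i - 1)" for i
  have sp: "s i < n" "p i < n" "s i \<noteq> p i" if "i < n" for i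
    using that n by (auto simp: s_def p_def)
  have nb: "adj G (c i) (c j) \<longleftrightarrow> j = s i \<or> j = p i" if "i < n" "j < n" for i j
    using r that n by (auto simp: s_def p_def)
  have CG: "?C \<subseteq> verts G"
    using nb sp adj_verts[OF wf] by blast
  have "?C \<noteq> {}" using n by (auto simp: lessThan_empty_iff)
  with CG obtain Y where Y: "Y \<in> blocks G" "?C \<subseteq> Y" using bicon_in_block[OF wf _ _ bi] by blast
  have YG: "Y \<subseteq> verts G" using Y blocks_iff[OF wf] by blast
  have CY: "?C \<subseteq> verts (induced G Y)" using CG Y by (simp add: verts_induced)
  have "chordal (induced G Y)" using G P Y by (simp add: P_block_graph_def)
  moreover have "card ?C \<ge> 4" using n c by (simp add: card_image)
  moreover have "connected (induced (induced G Y) ?C)"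
    using connected_induced[OF CY] bi \<open>?C \<noteq> {}\<close> Int_absorb1[OF Y(2)]
    by (simp add: bicon_def con_def adj_induced within_within)
  moreover have "card {u \<in> ?C. adj (induced G Y) v u} = 2" if v: "v \<in> ?C" for v
  proof -
    obtain i where i: "v = c i" "i < n" using v by auto
    have "{u \<in> ?C. adj (induced G Y) v u} = {c (s i), c (p i)}"
      using nb[OF i(2)] sp[OF i(2)] i Y(2) by (auto simp: adj_induced within_def)
    moreover have "c (s i) \<noteq> c (p i)" using sp[OF i(2)] c by (auto simp: inj_on_def)
    ultimately show ?thesis by simp
  qed
  ultimately show False using CY unfolding chordal_def by blast
qed

lemma P_block_graph_acyclic2:
  "P_block_graph P G \<Longrightarrow> \<forall>G\<in>P. chordal G \<Longrightarrow> acyclic2 (adj G)"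
  by (rule hole_free_acyclic2[OF symp_adj adj_irrefl P_block_graph_hole_free])

text \<open>A block stays connected without \<open>w\<close>, which provides the walk avoiding
  \<open>w\<close> that \<open>link_connected\<close> asks for.\<close>

lemma block_link:
  assumes "wf_graph G" "acyclic2 (adj G)" "X \<in> blocks G" "w \<in> X" "a \<in> X" "b \<in> X" "adj G w a" "adj G w b"
  shows "(link (adj G) w)\<^sup>*\<^sup>* a b"
proof (rule link_connected[OF symp_adj adj_irrefl assms(2,7,8)])
  have "con (adj G) (X - {w})" using assms by (simp add: blocks_iff bicon_def)
  moreover have "a \<in> X - {w}" "b \<in> X - {w}" using assms by auto
  ultimately have "(within (adj G) (X - {w}))\<^sup>*\<^sup>* a b" by (simp add: con_def)
  then show "(within (adj G) (- {w}))\<^sup>*\<^sup>* a b" by (rule within_mono[rotated]) auto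
qed

text \<open>Consecutive vertices of the chain form a triangle with \<open>w\<close>, and a block
  contains every triangle on one of its edges.\<close>

lemma link_in_block:
  assumes "wf_graph G" "X \<in> blocks G" "w \<in> X" "a \<in> X" "adj G w a" "(link (adj G) w)\<^sup>*\<^sup>* a b"
  shows "b \<in> X \<and> adj G w b"
  using assms(6)
proof induction
  case (step y z)
  then show ?case using block_triangle[OF assms(1-3), of y z] by (auto simp: link_def within_def)
qed (use assms in auto)

text \<open>In a block whose graph is \<open>acyclic2\<close>, any two edges are joined by a chain of triangles.\<close>
lemma block_edge_induct:
  assumes wf: "wf_graph G" and ac: "acyclic2 (adj G)" and X: "X \<in> blocks G"
    and base: "x \<in> X" "y \<in> X" "adj G x y" "R x y"
    and symR: "\<And>x y. R x y \<Longrightarrow> R y x"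
    and step: "\<And>x y z. x \<in> X \<Longrightarrow> y \<in> X \<Longrightarrow> z \<in> X \<Longrightarrow> adj G x y \<Longrightarrow> adj G x z \<Longrightarrow> adj G y z \<Longrightarrow> R x y \<Longrightarrow> R x z"
    and uv: "u \<in> X" "v \<in> X" "adj G u v"
  shows "R u v"
proof -
  have star: "R w b" if "w \<in> X" "a \<in> X" "b \<in> X" "adj G w a" "adj G w b" "R w a" for w a b
  proof -
    have "(link (adj G) w)\<^sup>*\<^sup>* a b" using block_link[OF wf ac X that(1-5)] .
    then have "R w b \<and> b \<in> X \<and> adj G w b"
    proof induction
      case (step y z)
      then have "adj G w y" "adj G w z" "adj G y z" "y \<in> X" by (auto simp: link_def within_def)
      moreover have "z \<in> X" using block_triangle[OF wf X that(1) \<open>y \<in> X\<close>] calculation by blast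
      ultimately show ?case using assms(9)[of w y z] step that(1) by blast
    qed (use that in auto)
    then show ?thesis by blast
  qed
  have "(within (adj G) X)\<^sup>*\<^sup>* x u" using X base uv by (auto simp: blocks_iff[OF wf] bicon_def con_def)
  \<comment> \<open>The induction follows a walk from \<open>x\<close>. The edge just used is turned
    by \<open>symR\<close> into one at the next vertex, from which \<open>star\<close> reaches all
    others there.\<close>
  then have "\<forall>a\<in>X. adj G u a \<longrightarrow> R u a"
  proof induction
    case base
    then show ?case using star[of x y] assms(4-7) by blast
  next
    case (step y z)
    then have "R z y" "adj G z y" "y \<in> X" "z \<in> X" using symR by (auto simp: within_def adj_sym)
    then show ?case using star[of z y] by blast
  qed
  then show ?thesis using uv by blast
qed

definition component_of :: "('a \<Rightarrow> 'a \<Rightarrow> bool) \<Rightarrow> 'a \<Rightarrow> 'a set" where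
  "component_of r x = {y. r\<^sup>*\<^sup>* x y}"

lemma component_of_self [simp]: "x \<in> component_of r x"
  by (simp add: component_of_def)

lemma component_of_eq:
  assumes "symp r" "r\<^sup>*\<^sup>* x y"
  shows "component_of r x = component_of r y"
  using assms(2) rtranclp_sym[OF assms] by (auto simp: component_of_def)

text \<open>Reachability classes are handy for walks, whereas the nodes of \<open>aux_sum\<close>
  are maximal connected sets.\<close>

lemma component_of_components:
  assumes wf: "wf_graph G" and x: "x \<in> verts G"
  shows "component_of (adj G) x \<in> components G"
proof -
  let ?C = "component_of (adj G) x"
  have sub: "?C \<subseteq> verts G"
  proof
    fix y assume "y \<in> ?C"
    then have "(adj G)\<^sup>*\<^sup>* x y" by (simp add: component_of_def)
    then show "y \<in> verts G" by (induction rule: rtranclp_induct) (use x adj_verts[OF wf] in auto)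
  qed
  have reach: "(within (adj G) ?C)\<^sup>*\<^sup>* x y" if "y \<in> ?C" for y
  proof -
    have "(adj G)\<^sup>*\<^sup>* x y" using that by (simp add: component_of_def)
    then show ?thesis
    proof induction
      case (step y z)
      then have "within (adj G) ?C y z"
        by (auto simp: within_def component_of_def intro: rtranclp.rtrancl_into_rtrancl)
      then show ?case using step.IH by (rule rtranclp.rtrancl_into_rtrancl[rotated])
    qed simp
  qed
  have "con (adj G) ?C"
    unfolding con_def
    using reach rtranclp_sym[OF within_symp[OF symp_adj] reach] by (blast intro: rtranclp_trans)
  moreover have "C' = ?C" if C': "?C \<subseteq> C'" "C' \<subseteq> verts G" "connected (induced G C')" for C'
  proof
    show "C' \<subseteq> ?C"
    proof
      fix y assume "y \<in> C'"
      moreover have "x \<in> C'" using C'(1) by (rule subsetD) simp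
      ultimately have "(within (adj G) C')\<^sup>*\<^sup>* x y"
        using C'(3) connected_induced[OF C'(2)] by (simp add: con_def)
      then have "(adj G)\<^sup>*\<^sup>* x y" by (rule rtranclp_subrel[rotated]) (simp add: within_def)
      then show "y \<in> ?C" by (simp add: component_of_def)
    qed
  qed (rule C')
  moreover have "?C \<noteq> {}" using component_of_self[of x "adj G"] by blast
  ultimately show ?thesis using connected_induced[OF sub] sub by (auto simp: components_def)
qed

lemma wf_induced: "wf_graph G \<Longrightarrow> wf_graph (induced G A)"
  unfolding wf_graph_def by (fastforce simp: induced_def verts_def edges_def)

section \<open>Gluing two graphs along S\<close>

lemma adj_gsum: "adj (gsum G H) x y \<longleftrightarrow> adj G x y \<or> adj H x y"
  by (auto simp: adj_def gsum_def edges_def)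

lemma verts_gsum: "verts (gsum G H) = verts G \<union> verts H"
  by (simp add: gsum_def verts_def)

lemma wf_gsum: "wf_graph G \<Longrightarrow> wf_graph H \<Longrightarrow> wf_graph (gsum G H)"
  unfolding wf_graph_def by (fastforce simp: gsum_def verts_def edges_def)

lemma gsum_commute: "gsum G H = gsum H G"
  by (simp add: gsum_def Un_commute)

text \<open>Compatibility without labels. The conditions are symmetric, so \<open>flip\<close> turns
  each statement about \<open>G\<close> into one about \<open>H\<close>.\<close>

locale glued =
  fixes G H :: "'v graph" and S :: "'v set"
  assumes wfG: "wf_graph G" and wfH: "wf_graph H"
    and SG: "S \<subseteq> verts G" and SH: "S \<subseteq> verts H"
    and disj: "(verts G - S) \<inter> (verts H - S) = {}"
    and eq: "induced G S = induced H S"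
begin

abbreviation "K \<equiv> gsum G H"

lemma flip: "glued H G S"
  using wfG wfH SG SH disj eq by unfold_locales auto

lemma wfK: "wf_graph K"
  using wf_gsum wfG wfH .

lemma verts_Int: "x \<in> verts G \<Longrightarrow> x \<in> verts H \<Longrightarrow> x \<in> S"
  using disj by blast

lemma adj_S: "x \<in> S \<Longrightarrow> y \<in> S \<Longrightarrow> adj G x y \<longleftrightarrow> adj H x y"
  using arg_cong[OF eq, of adj] unfolding adj_induced by (metis within_def)

lemma adjG: "adj G x y \<Longrightarrow> adj K x y" and adjH: "adj H x y \<Longrightarrow> adj K x y"
  by (simp_all add: adj_gsum)

text \<open>An edge of \<open>H\<close> between vertices of \<open>G\<close> has both ends in
  \<open>S\<close>, where the two graphs agree.\<close>

lemma adj_K_G: "adj K x y \<Longrightarrow> x \<in> verts G \<Longrightarrow> y \<in> verts G \<Longrightarrow> adj G x y"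
  using adj_S adj_verts[OF wfH] verts_Int unfolding adj_gsum by blast

lemma adj_K_outside: "adj K x y \<Longrightarrow> x \<in> verts G - S \<Longrightarrow> adj G x y"
  using adj_verts[OF wfH] verts_Int unfolding adj_gsum by blast

lemma adj_both: "adj G x y \<Longrightarrow> adj H x y \<Longrightarrow> x \<in> S \<and> y \<in> S"
  using adj_verts[OF wfG, of x y] adj_verts[OF wfH, of x y] verts_Int by simp

text \<open>On the parts the cocycle has potentials \<open>p\<close> and \<open>q\<close>, whose
  difference is constant on each component of \<open>G[S]\<close>. Each may still be shifted by a
  constant on every component of \<open>G\<close> or \<open>H\<close>. Making them agree on
  \<open>S\<close> is an equation for each edge of the auxiliary graph, and on a forest such a
  system is solvable.\<close>

lemma acyclic2_gsum:
  assumes "acyclic2 (adj G)" "acyclic2 (adj H)" and nc: "\<not> has_cycle (aux_sum G H S)"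
  shows "acyclic2 (adj K)"
  unfolding acyclic2_def
proof (intro allI impI)
  fix f assume f: "cocycle (adj K) f"
  have "cocycle (adj G) f" "cocycle (adj H) f"
    using f unfolding cocycle_def adj_gsum by metis+
  then obtain p q where "potential (adj G) f p" "potential (adj H) f q"
    using assms unfolding acyclic2_def by blast
  then have p: "\<And>x y. adj G x y \<Longrightarrow> (f x y \<longleftrightarrow> p x \<noteq> p y)"
    and q: "\<And>x y. adj H x y \<Longrightarrow> (f x y \<longleftrightarrow> q x \<noteq> q y)"
    unfolding potential_def by blast+
  let ?T = "adj (induced G S)"
  have T: "adj G x y" "adj H x y" if "?T x y" for x y
    using that adj_S by (auto simp: adj_induced within_def)
  \<comment> \<open>The value does not depend on the vertex picked by \<open>SOME\<close>, because
    \<open>p\<close> and \<open>q\<close> change alike along edges inside \<open>S\<close>.\<close>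
  define \<delta> where "\<delta> C \<longleftrightarrow> p (SOME x. x \<in> C) \<noteq> q (SOME x. x \<in> C)" for C
  have \<delta>: "\<delta> (component_of ?T x) \<longleftrightarrow> p x \<noteq> q x" for x
  proof -
    have "(SOME y. y \<in> component_of ?T x) \<in> component_of ?T x"
      by (rule someI[of "\<lambda>y. y \<in> component_of ?T x" x]) simp
    then have "?T\<^sup>*\<^sup>* x (SOME y. y \<in> component_of ?T x)" by (simp add: component_of_def)
    moreover have "(p x \<noteq> q x) = (p y \<noteq> q y)" if "?T\<^sup>*\<^sup>* x y" for y
      using that
    proof induction
      case (step y z)
      then show ?case using p[OF T(1), of y z] q[OF T(2), of y z] by blast
    qed simp
    ultimately show ?thesis unfolding \<delta>_def by blast
  qed
  let ?A = "aux_sum G H S"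
  \<comment> \<open>The whole discrepancy is charged to the edges between \<open>CompG\<close> and
    \<open>CompS\<close>; those at \<open>CompH\<close> get \<open>False\<close>. Both orders are
    listed because \<open>forest_potential\<close> wants symmetric labels.\<close>
  define c where "c u v = (case (u, v) of (CompG _, CompS C) \<Rightarrow> \<delta> C | (CompS C, CompG _) \<Rightarrow> \<delta> C | _ \<Rightarrow> False)"
    for u v :: "'v auxnode"
  have "finite (components J)" if "wf_graph J" for J :: "'v graph"
    using finite_verts[OF that] by (auto simp: components_def intro: finite_subset[of _ "Pow (verts J)"])
  then have fin: "finite (verts ?A)"
    using wfG wfH wf_induced[OF wfG] by (simp add: aux_sum_def verts_def)
  have "\<exists>\<pi>. potential (within (adj ?A) (verts ?A)) c \<pi>"
  proof (rule forest_potential[OF fin symp_adj])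
    show "\<not> (\<exists>vs. 3 \<le> length vs \<and> distinct vs \<and> set vs \<subseteq> verts ?A \<and>
        (\<forall>i<length vs. adj ?A (vs ! i) (vs ! ((i + 1) mod length vs))))"
      using nc by (simp add: has_cycle_def)
  qed (auto simp: c_def split: auxnode.splits)
  then obtain \<pi> where \<pi>: "potential (within (adj ?A) (verts ?A)) c \<pi>" ..
  let ?g = "\<lambda>x. \<pi> (CompG (component_of (adj G) x))" and ?h = "\<lambda>x. \<pi> (CompH (component_of (adj H) x))"
  \<comment> \<open>The shifts \<open>?g x\<close> and \<open>?h x\<close> differ exactly when
    \<open>\<delta>\<close> holds for the component of \<open>x\<close>, as seen along the two
    auxiliary edges at that component.\<close>
  have S: "(p x \<noteq> ?g x) \<longleftrightarrow> (q x \<noteq> ?h x)" if x: "x \<in> S" for x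
  proof -
    let ?G = "component_of (adj G) x" and ?H = "component_of (adj H) x" and ?C = "component_of ?T x"
    have mem: "?G \<in> components G" "?H \<in> components H" "?C \<in> components (induced G S)"
      using component_of_components[OF wfG, of x] component_of_components[OF wfH, of x]
        component_of_components[OF wf_induced[OF wfG, of S], of x] x SG SH by (simp_all add: verts_induced subset_iff)
    have sub: "?C \<subseteq> ?G" "?C \<subseteq> ?H"
      unfolding component_of_def using rtranclp_subrel[of ?T] T by blast+
    have "within (adj ?A) (verts ?A) (CompG ?G) (CompS ?C)" "within (adj ?A) (verts ?A) (CompH ?H) (CompS ?C)"
      using mem sub eq by (auto simp: within_def adj_def aux_sum_def verts_def edges_def)
    then have "c (CompG ?G) (CompS ?C) \<longleftrightarrow> ?g x \<noteq> \<pi> (CompS ?C)" "c (CompH ?H) (CompS ?C) \<longleftrightarrow> ?h x \<noteq> \<pi> (CompS ?C)"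
      using \<pi> unfolding potential_def by blast+
    then show ?thesis using \<delta>[of x] by (auto simp: c_def)
  qed
  define P where "P x = (if x \<in> verts G then p x \<noteq> ?g x else q x \<noteq> ?h x)" for x
  have PG: "P x = (p x \<noteq> ?g x)" if "x \<in> verts G" for x using that by (simp add: P_def)
  have PH: "P x = (q x \<noteq> ?h x)" if "x \<in> verts H" for x
    using that S[of x] verts_Int[of x] by (auto simp: P_def)
  have "f x y \<longleftrightarrow> P x \<noteq> P y" if "adj K x y" for x y
    using that unfolding adj_gsum
  proof
    assume a: "adj G x y"
    then show ?thesis
      using PG[of x] PG[of y] p[OF a] adj_verts[OF wfG a] component_of_eq[OF symp_adj r_into_rtranclp[of "adj G", OF a]]
      by auto
  next
    assume a: "adj H x y"
    then show ?thesis
      using PH[of x] PH[of y] q[OF a] adj_verts[OF wfH a] component_of_eq[OF symp_adj r_into_rtranclp[of "adj H", OF a]]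
      by auto
  qed
  then show "\<exists>P. potential (adj K) f P" unfolding potential_def by blast
qed

lemma bicon_part: "A \<subseteq> verts G \<Longrightarrow> bicon (adj K) A \<longleftrightarrow> bicon (adj G) A"
proof -
  assume A: "A \<subseteq> verts G"
  have "within (adj K) B = within (adj G) B" if "B \<subseteq> A" for B
    using subset_trans[OF that A] adj_K_G adjG by (intro ext) (auto simp: within_def subset_iff)
  then have "con (adj K) B \<longleftrightarrow> con (adj G) B" if "B \<subseteq> A" for B
    using that by (simp add: con_def)
  then show ?thesis unfolding bicon_def by (metis Diff_subset order_refl)
qed

lemma induced_part: "A \<subseteq> verts G \<Longrightarrow> induced K A = induced G A"
proof -
  assume A: "A \<subseteq> verts G"
  have "e \<in> edges G" if e: "e \<in> edges H" "e \<subseteq> A" for e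
  proof -
    obtain u v where uv: "e = {u, v}" "u \<noteq> v" using e wfH by (auto simp: wf_graph_def)
    then have "adj H u v" "u \<in> verts G" "v \<in> verts G" using e A by (auto simp: adj_def)
    then have "adj K u v" "u \<in> verts G" "v \<in> verts G" using adjH by auto
    then have "adj G u v" using adj_K_G by blast
    then show ?thesis using uv by (simp add: adj_def)
  qed
  then show ?thesis using A by (auto simp: induced_def gsum_def verts_def edges_def)
qed

lemma block_part:
  assumes X: "X \<in> blocks K" and XG: "X \<subseteq> verts G"
  shows "X \<in> blocks G"
proof -
  have "X' = X" if "X \<subseteq> X'" "X' \<subseteq> verts G" "bicon (adj G) X'" for X'
    using block_maximal[OF wfK X that(1)] that bicon_part by (auto simp: verts_gsum)
  then show ?thesis
    unfolding blocks_iff[OF wfG] using X XG block_nonempty[OF wfK X] block_bicon[OF wfK X] bicon_part by blast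
qed

lemma part_block:
  assumes Y: "Y \<in> blocks G"
  obtains X where "X \<in> blocks K" "Y \<subseteq> X"
proof -
  have "bicon (adj K) Y" "Y \<noteq> {}" "Y \<subseteq> verts K"
    using block_bicon[OF wfG Y] block_nonempty[OF wfG Y] block_verts[OF wfG Y] bicon_part by (auto simp: verts_gsum)
  then show thesis using bicon_in_block[OF wfK] that by blast
qed

lemma part_block_subset:
  assumes "Y \<in> blocks G" "X \<in> blocks K" "x \<in> X" "x \<in> Y" "y \<in> X" "y \<in> Y" "x \<noteq> y"
  shows "Y \<subseteq> X"
  using block_absorb[OF wfK assms(2), of Y x y] assms block_bicon[OF wfG assms(1)] block_verts[OF wfG assms(1)]
    bicon_part by (simp add: verts_gsum le_supI1)

text \<open>A vertex outside \<open>S\<close> belongs to one part, together with all its edges, and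
  a triangle inside \<open>S\<close> belongs to both. So triangles never straddle, and properties
  can be passed from part to part along them.\<close>

lemma triangle_part:
  assumes "adj K x y" "adj K x z" "adj K y z"
  shows "(adj G x y \<and> adj G x z \<and> adj G y z) \<or> (adj H x y \<and> adj H x z \<and> adj H y z)"
proof -
  have "x \<in> verts G \<and> y \<in> verts G \<and> z \<in> verts G \<or> x \<in> verts H \<and> y \<in> verts H \<and> z \<in> verts H"
    using assms adj_verts[OF wfG] adj_verts[OF wfH] verts_Int SG SH unfolding adj_gsum by blast
  then show ?thesis
    using assms adj_K_G glued.adj_K_G[OF flip, unfolded gsum_commute[of H G]] by blast
qed

text \<open>An edge not inside \<open>S\<close> belongs to exactly one part. If all edges are of
  this kind, triangles with a common edge lie in the same part, and a chain of triangles never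
  leaves it.\<close>

lemma block_without_S_edge:
  assumes ac: "acyclic2 (adj K)" and X: "X \<in> blocks K"
    and noS: "\<And>x y. x \<in> X \<Longrightarrow> y \<in> X \<Longrightarrow> x \<in> S \<Longrightarrow> y \<in> S \<Longrightarrow> \<not> adj K x y"
  shows "X \<in> blocks G \<or> X \<in> blocks H"
proof -
  have "X \<subseteq> verts G \<or> X \<subseteq> verts H"
  proof (cases "\<exists>x\<in>X. \<exists>y\<in>X. adj K x y")
    case True
    then obtain x y where xy: "x \<in> X" "y \<in> X" "adj K x y" by blast
    have all: "R u v" if R: "R x y" "\<And>x y. R x y \<Longrightarrow> R y x"
        "\<And>x y z. adj K x y \<Longrightarrow> adj K x z \<Longrightarrow> adj K y z \<Longrightarrow> \<not> (x \<in> S \<and> y \<in> S) \<Longrightarrow> R x y \<Longrightarrow> R x z"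
        "u \<in> X" "v \<in> X" "adj K u v" for R :: "'v \<Rightarrow> 'v \<Rightarrow> bool" and u v
    proof (rule block_edge_induct[where R = R, OF wfK ac X xy R(1) _ _ R(4-6)])
      fix x y z assume "x \<in> X" "y \<in> X" "adj K x y" "adj K x z" "adj K y z" "R x y"
      then show "R x z" using R(3) noS by blast
    qed (rule R(2))
    have nb: "\<exists>v\<in>X. adj K u v" if u: "u \<in> X" for u
      using block_neighbour[OF wfK X u] u xy adj_irrefl[of K] by metis
    from xy(3) show ?thesis unfolding adj_gsum
    proof
      assume a: "adj G x y"
      have cl: "adj G u v" if "u \<in> X" "v \<in> X" "adj K u v" for u v
        by (rule all[where R = "adj G", OF a adj_sym _ that]) (use triangle_part adj_both in blast)+
      have "u \<in> verts G" if "u \<in> X" for u using nb[OF that] cl[OF that] adj_verts(1)[OF wfG] by blast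
      then show ?thesis by blast
    next
      assume a: "adj H x y"
      have cl: "adj H u v" if "u \<in> X" "v \<in> X" "adj K u v" for u v
        by (rule all[where R = "adj H", OF a adj_sym _ that]) (use triangle_part adj_both in blast)+
      have "u \<in> verts H" if "u \<in> X" for u using nb[OF that] cl[OF that] adj_verts(1)[OF wfH] by blast
      then show ?thesis by blast
    qed
  next
    case False
    obtain x where x: "x \<in> X" using block_nonempty[OF wfK X] by blast
    have "X = {x}" using False x block_neighbour[OF wfK X x] by blast
    then show ?thesis using block_verts[OF wfK X] by (auto simp: verts_gsum)
  qed
  then show ?thesis
    using block_part[OF X] glued.block_part[OF flip] X gsum_commute[of H G] by auto
qed

end

section \<open>Labellings as embeddings\<close>

definition embeds :: "('a \<Rightarrow> 'a \<Rightarrow> bool) \<Rightarrow> ('a \<Rightarrow> 'b) \<Rightarrow> 'a set \<Rightarrow> ('b \<Rightarrow> 'b \<Rightarrow> bool) \<Rightarrow> bool" where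
  "embeds r L X s \<longleftrightarrow> inj_on L X \<and> (\<forall>u\<in>X. \<forall>v\<in>X. r u v \<longleftrightarrow> s (L u) (L v))"

lemma embedsD:
  assumes "embeds r L X s" "u \<in> X" "v \<in> X"
  shows "r u v \<longleftrightarrow> s (L u) (L v)" "L u = L v \<longleftrightarrow> u = v"
  using assms by (auto simp: embeds_def inj_on_eq_iff)

lemma embeds_subset: "embeds r L X s \<Longrightarrow> Y \<subseteq> X \<Longrightarrow> embeds r L Y s"
  by (auto simp: embeds_def intro: inj_on_subset)

lemma embeds_cong:
  assumes "\<And>u. u \<in> X \<Longrightarrow> L u = L' u" "\<And>u v. u \<in> X \<Longrightarrow> v \<in> X \<Longrightarrow> r u v \<longleftrightarrow> r' u v"
  shows "embeds r L X s \<longleftrightarrow> embeds r' L' X s"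
  using assms inj_on_cong[of X L L'] by (simp add: embeds_def)

lemma embeds_con:
  assumes "embeds r L X s" "A \<subseteq> X" "con r A"
  shows "con s (L ` A)"
proof -
  have "(within s (L ` A))\<^sup>*\<^sup>* (L u) (L v)" if "(within r A)\<^sup>*\<^sup>* u v" for u v
    using that
  proof induction
    case (step y z)
    then have "within s (L ` A) (L y) (L z)" using assms(1,2) by (auto simp: within_def embeds_def)
    then show ?case using step.IH by (rule rtranclp.rtrancl_into_rtrancl[rotated])
  qed simp
  then show ?thesis using assms(3) unfolding con_def by blast
qed

lemma embeds_bicon:
  assumes "embeds r L X s" "bicon r X"
  shows "bicon s (L ` X)"
proof -
  have "L ` X - {L v} = L ` (X - {v})" if "v \<in> X" for v
    using assms(1) that by (auto simp: embeds_def inj_on_eq_iff)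
  then show ?thesis
    using assms(2) embeds_con[OF assms(1)] by (auto simp: bicon_def)
qed

lemma hole_free_embeds:
  assumes hf: "hole_free s" and emb: "embeds r L X s" and X: "\<And>x y. r x y \<Longrightarrow> x \<in> X"
  shows "hole_free r"
  unfolding hole_free_def
proof (rule notI, elim exE conjE)
  fix n c
  assume n: "n \<ge> (4::nat)" and c: "inj_on c {..<n}"
    and r: "\<forall>i<n. \<forall>j<n. r (c i) (c j) \<longleftrightarrow>
        j = Suc i \<or> i = Suc j \<or> (i = 0 \<and> j = n - 1) \<or> (j = 0 \<and> i = n - 1)"
  have cX: "c i \<in> X" if i: "i < n" for i
  proof (cases "i = 0")
    case True
    then have "r (c i) (c 1)" using r n by auto
    then show ?thesis by (rule X)
  next
    case False
    then have "r (c i) (c (i - 1))" using r i by auto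
    then show ?thesis by (rule X)
  qed
  then have "c ` {..<n} \<subseteq> X" by auto
  then have "inj_on L (c ` {..<n})" using emb inj_on_subset by (auto simp: embeds_def)
  then have "inj_on (L \<circ> c) {..<n}" by (rule comp_inj_on[OF c])
  moreover have "\<forall>i<n. \<forall>j<n. s ((L \<circ> c) i) ((L \<circ> c) j) \<longleftrightarrow>
        j = Suc i \<or> i = Suc j \<or> (i = 0 \<and> j = n - 1) \<or> (j = 0 \<and> i = n - 1)"
    using r cX embedsD(1)[OF emb] by simp
  ultimately show False using hf n unfolding hole_free_def by blast
qed

lemma hole_free_within: "hole_free r \<Longrightarrow> hole_free (within r A)"
  by (rule hole_free_embeds[where L = id and X = A and s = r]) (auto simp: embeds_def within_def)

text \<open>Connectedness of \<open>X\<close> makes \<open>L\<close> injective by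
  \<open>cover_inj\<close>; connectedness of \<open>V\<close> makes it onto, since walks in
  \<open>V\<close> lift. Holes are excluded in \<open>V\<close> because the source is not known to
  be chordal. The lemma serves first for neighbourhoods and then for whole blocks.\<close>

lemma cover_iso:
  assumes symr: "symp r" and syms: "symp s" and irr: "\<And>i. \<not> s i i" and hf: "hole_free s"
    and X: "con r X" "X \<noteq> {}" and V: "con s V" "L ` X \<subseteq> V"
    and loc: "\<And>x. x \<in> X \<Longrightarrow> embeds r L {y \<in> X. r x y} s"
    and img: "\<And>x. x \<in> X \<Longrightarrow> L ` {y \<in> X. r x y} = {i \<in> V. s (L x) i}"
  shows "embeds r L X s \<and> L ` X = V"
proof -
  have inj: "x = y" if xy: "x \<in> X" "y \<in> X" "L x = L y" for x y
  proof (rule cover_inj[where r = "within r X" and s = "within s V" and \<phi> = L])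
    show "\<And>x y. within r X x y \<Longrightarrow> within s V (L x) (L y)"
      using img V(2) unfolding within_def by blast
    show "\<exists>y. within r X x y \<and> L y = b" if "within s V (L x) b" "within r X x x'" for x x' b
    proof -
      have "x \<in> X" "b \<in> L ` {y \<in> X. r x y}" using that img[of x] by (auto simp: within_def)
      then show ?thesis by (auto simp: within_def)
    qed
    show "y = z" if "within r X x y" "within r X x z" "L y = L z" for x y z
      using that loc[of x] by (auto simp: within_def embeds_def inj_on_def)
    show "within r X y z" if "within r X x y" "within r X x z" "within s V (L y) (L z)" for x y z
      using that loc[of x] by (auto simp: within_def embeds_def)
    show "(within r X)\<^sup>*\<^sup>* x y" using X xy by (simp add: con_def)
  qed (use irr xy within_symp[OF symr] within_symp[OF syms] hole_free_within[OF hf] in \<open>auto simp: within_def\<close>)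
  then have "inj_on L X" by (auto simp: inj_on_def)
  moreover have "r x y \<longleftrightarrow> s (L x) (L y)" if xy: "x \<in> X" "y \<in> X" for x y
  proof
    assume "r x y"
    then show "s (L x) (L y)" using img[of x] xy by blast
  next
    assume "s (L x) (L y)"
    then have "L y \<in> L ` {y \<in> X. r x y}" using img[of x] xy V(2) by blast
    then show "r x y" using inj xy by auto
  qed
  moreover have "V \<subseteq> L ` X"
  proof
    fix i assume i: "i \<in> V"
    obtain x where x: "x \<in> X" using X(2) by blast
    then have "(within s V)\<^sup>*\<^sup>* (L x) i" using V i by (auto simp: con_def)
    then show "i \<in> L ` X"
    proof induction
      case (step j k)
      then obtain y where "y \<in> X" "L y = j" by blast
      then have "k \<in> L ` {z \<in> X. r y z}" using img[of y] step.hyps by (auto simp: within_def)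
      then show ?case by blast
    qed (use x in blast)
  qed
  ultimately show ?thesis using V(2) by (auto simp: embeds_def)
qed

section \<open>Label relations and characteristics\<close>

text \<open>A graph with injective labels is replaced by its image on the labels. Every
  label-preserving isomorphism to \<open>F\<close> then becomes the labelling itself, and agreement
  of two such graphs becomes an equality of relations.\<close>

definition label_rel :: "'w graph \<times> ('w \<Rightarrow> nat) \<Rightarrow> nat \<Rightarrow> nat \<Rightarrow> bool" where
  "label_rel F i j \<longleftrightarrow> (\<exists>u\<in>verts (fst F). \<exists>v\<in>verts (fst F). adj (fst F) u v \<and> snd F u = i \<and> snd F v = j)"

definition labels :: "'w graph \<times> ('w \<Rightarrow> nat) \<Rightarrow> nat set" where
  "labels F = snd F ` verts (fst F)"

lemma label_rel_labels: "label_rel F i j \<Longrightarrow> i \<in> labels F \<and> j \<in> labels F"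
  by (auto simp: label_rel_def labels_def)

lemma symp_label_rel: "symp (label_rel F)"
  using adj_sym[of "fst F"] unfolding symp_def label_rel_def by blast

lemma induced_verts: "wf_graph Q \<Longrightarrow> induced Q (verts Q) = Q"
  by (auto simp: induced_def verts_def edges_def wf_graph_def prod_eq_iff)

lemma biconnected_block:
  assumes "wf_graph Q" "biconnected Q"
  shows "verts Q \<in> blocks Q"
  using assms by (auto simp: blocks_def induced_verts)

text \<open>A biconnected graph is its own block, so what is demanded of blocks holds for the whole
  graph.\<close>

lemma U_D:
  assumes "F \<in> U d P"
  shows "P_block_graph P (fst F)" "wf_graph (fst F)" "fst F \<in> P" "card (verts (fst F)) \<le> d" "labels F \<subseteq> {1..d}"
    "inj_on (snd F) (verts (fst F))" "bicon (adj (fst F)) (verts (fst F))" "verts (fst F) \<noteq> {}"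
proof -
  have a: "biconnected (fst F)" "P_block_graph P (fst F)" "block_labeling d (fst F) (snd F)"
    using assms by (auto simp: U_def d_labeled_P_block_def)
  then show "P_block_graph P (fst F)" and wf: "wf_graph (fst F)" by (simp_all add: P_block_graph_def)
  have b: "verts (fst F) \<in> blocks (fst F)" using biconnected_block wf a by blast
  show "fst F \<in> P" using a b induced_verts[OF wf] by (force simp: P_block_graph_def)
  show "card (verts (fst F)) \<le> d" "labels F \<subseteq> {1..d}" "inj_on (snd F) (verts (fst F))"
    using a(3) b by (auto simp: block_labeling_def labels_def)
  show "bicon (adj (fst F)) (verts (fst F))" "verts (fst F) \<noteq> {}"
    using block_bicon[OF wf b] block_nonempty[OF wf b] .
qed

lemma U_embeds:
  assumes "F \<in> U d P"
  shows "embeds (adj (fst F)) (snd F) (verts (fst F)) (label_rel F)"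
  using U_D(6)[OF assms] by (auto simp: embeds_def label_rel_def inj_on_eq_iff)

lemma label_rel_irrefl:
  assumes "F \<in> U d P"
  shows "\<not> label_rel F i i"
proof
  assume "label_rel F i i"
  then obtain u v where "u \<in> verts (fst F)" "v \<in> verts (fst F)" "adj (fst F) u v" "snd F u = snd F v"
    by (auto simp: label_rel_def)
  then show False using inj_onD[OF U_D(6)[OF assms]] adj_irrefl by metis
qed

lemma label_rel_bicon: "F \<in> U d P \<Longrightarrow> bicon (label_rel F) (labels F)"
  unfolding labels_def by (rule embeds_bicon[OF U_embeds U_D(7)])

text \<open>The inverse of the labelling carries a hole among the labels back to one in the
  graph.\<close>

lemma label_rel_hole_free:
  assumes F: "F \<in> U d P" and P: "\<forall>G\<in>P. chordal G"
  shows "hole_free (label_rel F)"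
proof (rule hole_free_embeds[OF P_block_graph_hole_free[OF U_D(1)[OF F] P]])
  let ?f = "the_inv_into (verts (fst F)) (snd F)"
  note inj = U_D(6)[OF F]
  show "embeds (label_rel F) ?f (labels F) (adj (fst F))"
    unfolding embeds_def labels_def
  proof (intro conjI ballI)
    show "inj_on ?f (snd F ` verts (fst F))" by (rule inj_on_the_inv_into[OF inj])
    fix i j assume "i \<in> snd F ` verts (fst F)" "j \<in> snd F ` verts (fst F)"
    then obtain u v where "i = snd F u" "j = snd F v" "u \<in> verts (fst F)" "v \<in> verts (fst F)" by blast
    then show "label_rel F i j \<longleftrightarrow> adj (fst F) (?f i) (?f j)"
      using embedsD(1)[OF U_embeds[OF F], of u v] by (simp add: the_inv_into_f_f[OF inj])
  qed
  show "\<And>i j. label_rel F i j \<Longrightarrow> i \<in> labels F" using label_rel_labels by blast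
qed

lemma label_iso_embeds:
  assumes F: "F \<in> U d P" and A: "A \<subseteq> verts (fst F)"
    and iso: "label_iso (J, L) (induced (fst F) A, snd F)"
  shows "embeds (adj J) L (verts J) (label_rel F) \<and> L ` verts J = snd F ` A"
proof -
  obtain f where f: "bij_betw f (verts J) A"
      "\<And>u v. u \<in> verts J \<Longrightarrow> v \<in> verts J \<Longrightarrow> adj J u v \<longleftrightarrow> within (adj (fst F)) A (f u) (f v)"
      "\<And>v. v \<in> verts J \<Longrightarrow> snd F (f v) = L v"
    using iso A by (auto simp: label_iso_def graph_iso_def verts_induced adj_induced Int_absorb1)
  have fA: "f v \<in> A" if "v \<in> verts J" for v using f(1) that by (rule bij_betwE[rule_format])
  have fv: "f v \<in> verts (fst F)" if "v \<in> verts J" for v using fA[OF that] A by blast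
  have "inj_on L (verts J)"
  proof (rule inj_onI)
    fix u v assume uv: "u \<in> verts J" "v \<in> verts J" "L u = L v"
    then have "snd F (f u) = snd F (f v)" using f(3) by simp
    then have "f u = f v" using inj_onD[OF U_D(6)[OF F]] fv uv by blast
    then show "u = v" using f(1) uv by (auto simp: bij_betw_def inj_on_def)
  qed
  moreover have "adj J u v \<longleftrightarrow> label_rel F (L u) (L v)" if uv: "u \<in> verts J" "v \<in> verts J" for u v
    using f(2)[OF uv] embedsD(1)[OF U_embeds[OF F] fv fv, OF uv] f(3)[OF uv(1)] f(3)[OF uv(2)] fA uv
    by (simp add: within_def)
  moreover have "L ` verts J = snd F ` A"
  proof -
    have "snd F ` A = snd F ` f ` verts J" using f(1) by (simp add: bij_betw_def)
    also have "\<dots> = L ` verts J" using f(3) by (simp add: image_image)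
    finally show ?thesis by simp
  qed
  ultimately show ?thesis by (auto simp: embeds_def)
qed

lemma embeds_label_iso:
  assumes F: "F \<in> U d P" and emb: "embeds (adj J) L (verts J) (label_rel F)" and img: "L ` verts J = labels F"
  shows "label_iso (J, L) F"
proof -
  let ?f = "\<lambda>v. the_inv_into (verts (fst F)) (snd F) (L v)"
  note inj = U_D(6)[OF F]
  have Lv: "L v \<in> snd F ` verts (fst F)" if "v \<in> verts J" for v
    using img that by (auto simp: labels_def)
  have f: "?f v \<in> verts (fst F)" "snd F (?f v) = L v" if "v \<in> verts J" for v
    using the_inv_into_into[OF inj Lv[OF that] order_refl] f_the_inv_into_f[OF inj Lv[OF that]] .
  have "bij_betw ?f (verts J) (verts (fst F))"
  proof (rule bij_betwI')
    fix u v assume uv: "u \<in> verts J" "v \<in> verts J"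
    then show "?f u = ?f v \<longleftrightarrow> u = v" using f(2) embedsD(2)[OF emb] by metis
  next
    fix q assume q: "q \<in> verts (fst F)"
    then have "snd F q \<in> L ` verts J" using img by (auto simp: labels_def)
    then obtain v where "v \<in> verts J" "L v = snd F q" by auto
    then show "\<exists>v\<in>verts J. q = ?f v" using the_inv_into_f_f[OF inj q] by force
  qed (rule f)
  moreover have "adj J u v \<longleftrightarrow> adj (fst F) (?f u) (?f v)" if uv: "u \<in> verts J" "v \<in> verts J" for u v
    using embedsD(1)[OF emb uv] embedsD(1)[OF U_embeds[OF F] f(1) f(1), OF uv] f(2)[OF uv(1)] f(2)[OF uv(2)] by simp
  ultimately have "graph_iso J (fst F) ?f" by (simp add: graph_iso_def)
  then show ?thesis unfolding label_iso_def using f(2) by (intro exI[of _ ?f]) simp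
qed

lemma characteristicD:
  assumes ch: "characteristic d P G L S g h" and B: "B \<in> block_set G S" and X: "X \<in> blocks G" "B \<subseteq> X"
  shows "g B \<in> U d P" "partial_label_iso (induced G X, L) (g B)"
    "\<forall>B'\<in>block_set G S. B' \<subseteq> X \<longrightarrow> g B' = g B" "h B = L ` (nbhd_in G X B - S)"
    "\<forall>w. (w \<in> X - S \<or> (\<exists>C\<in>components (induced G S). X \<inter> C = {w})) \<longrightarrow>
            (\<forall>z\<in>verts (fst (g B)). snd (g B) z = L w \<longrightarrow>
               label_iso (induced G (cnbhd_in G X w), L)
                 (induced (fst (g B)) (cnbhd_in (fst (g B)) (verts (fst (g B))) z), snd (g B)))"
proof -
  note a = bspec[OF ch[unfolded characteristic_def] B]
  note b = mp[OF bspec[OF conjunct2[OF conjunct2[OF a]] X(1)] X(2)]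
  show "g B \<in> U d P" by (rule conjunct1[OF a])
  show "partial_label_iso (induced G X, L) (g B)" by (rule conjunct1[OF b])
  show "\<forall>B'\<in>block_set G S. B' \<subseteq> X \<longrightarrow> g B' = g B" by (rule conjunct1[OF conjunct2[OF b]])
  show "h B = L ` (nbhd_in G X B - S)" by (rule conjunct1[OF conjunct2[OF conjunct2[OF b]]])
  show "\<forall>w. (w \<in> X - S \<or> (\<exists>C\<in>components (induced G S). X \<inter> C = {w})) \<longrightarrow>
            (\<forall>z\<in>verts (fst (g B)). snd (g B) z = L w \<longrightarrow>
               label_iso (induced G (cnbhd_in G X w), L)
                 (induced (fst (g B)) (cnbhd_in (fst (g B)) (verts (fst (g B))) z), snd (g B)))"
    by (rule conjunct2[OF conjunct2[OF conjunct2[OF b]]])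
qed

text \<open>This is condition (a). The isomorphism is partial, so the labels of \<open>X\<close> may
  miss some of \<open>g B\<close>.\<close>

lemma characteristic_embeds:
  assumes ch: "characteristic d P G L S g h" and B: "B \<in> block_set G S" and X: "X \<in> blocks G" "B \<subseteq> X"
    and wf: "wf_graph G"
  shows "embeds (adj G) L X (label_rel (g B))" "L ` X \<subseteq> labels (g B)"
proof -
  note U = characteristicD(1)[OF ch B X] and p = characteristicD(2)[OF ch B X]
  have v: "verts (induced G X) = X" using block_verts[OF wf X(1)] by (simp add: verts_induced Int_absorb1)
  have "embeds (within (adj G) X) L X (label_rel (g B)) \<and> L ` X = snd (g B) ` {v \<in> verts (fst (g B)). snd (g B) v \<in> L ` X}"
    using label_iso_embeds[OF U, of "{v \<in> verts (fst (g B)). snd (g B) v \<in> L ` X}" "induced G X" L] p v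
    by (simp add: partial_label_iso_def adj_induced)
  moreover have "embeds (within (adj G) X) L X (label_rel (g B)) \<longleftrightarrow> embeds (adj G) L X (label_rel (g B))"
    by (rule embeds_cong) (auto simp: within_def)
  ultimately show "embeds (adj G) L X (label_rel (g B))" "L ` X \<subseteq> labels (g B)" by (auto simp: labels_def)
qed

text \<open>Condition (d) upgrades the inclusion from condition (a) to an equality at
  \<open>w\<close>: the other side of a sum has no label left to contribute there.\<close>

lemma characteristic_star:
  assumes ch: "characteristic d P G L S g h" and B: "B \<in> block_set G S" and X: "X \<in> blocks G" "B \<subseteq> X"
    and wf: "wf_graph G" and wX: "w \<in> X" and w: "w \<in> X - S \<or> (\<exists>C\<in>components (induced G S). X \<inter> C = {w})"
  shows "L ` {u \<in> X. adj G w u} = {i. label_rel (g B) (L w) i}"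
proof -
  note U = characteristicD(1)[OF ch B X]
  let ?Q = "fst (g B)" and ?LQ = "snd (g B)" and ?N = "{u \<in> X. adj G w u}"
  have "L w \<in> labels (g B)" using characteristic_embeds(2)[OF ch B X wf] wX by blast
  then obtain z where z: "z \<in> verts ?Q" "?LQ z = L w" by (auto simp: labels_def)
  have iso: "label_iso (induced G (cnbhd_in G X w), L) (induced ?Q (cnbhd_in ?Q (verts ?Q) z), ?LQ)"
    by (rule characteristicD(5)[OF ch B X, rule_format, OF w z])
  have "verts (induced G (cnbhd_in G X w)) = insert w ?N"
    using block_verts[OF wf X(1)] wX by (auto simp: verts_induced cnbhd_in_def)
  moreover have "cnbhd_in ?Q (verts ?Q) z \<subseteq> verts ?Q" using z by (auto simp: cnbhd_in_def)
  ultimately have "L ` insert w ?N = ?LQ ` (cnbhd_in ?Q (verts ?Q) z)"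
    using label_iso_embeds[OF U _ iso] by simp
  also have "\<dots> = insert (L w) (?LQ ` {u \<in> verts ?Q. adj ?Q z u})"
    using z by (simp add: cnbhd_in_def)
  also have "?LQ ` {u \<in> verts ?Q. adj ?Q z u} = {i. label_rel (g B) (L w) i}"
  proof (intro set_eqI iffI)
    fix i assume "i \<in> ?LQ ` {u \<in> verts ?Q. adj ?Q z u}"
    then show "i \<in> {i. label_rel (g B) (L w) i}" using z by (auto simp: label_rel_def)
  next
    fix i assume "i \<in> {i. label_rel (g B) (L w) i}"
    then obtain u v where uv: "u \<in> verts ?Q" "v \<in> verts ?Q" "adj ?Q u v" "?LQ u = L w" "?LQ v = i"
      by (auto simp: label_rel_def)
    then have "u = z" using inj_onD[OF U_D(6)[OF U]] z by metis
    then show "i \<in> ?LQ ` {u \<in> verts ?Q. adj ?Q z u}" using uv by blast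
  qed
  finally have e: "insert (L w) (L ` ?N) = insert (L w) {i. label_rel (g B) (L w) i}" by simp
  \<comment> \<open>The isomorphism compares closed neighbourhoods; the centre remains to be
    cancelled on both sides.\<close>
  have "L w \<notin> L ` ?N"
  proof
    assume "L w \<in> L ` ?N"
    then obtain u where u: "u \<in> X" "adj G w u" "L w = L u" by blast
    then have "w = u" using embedsD(2)[OF characteristic_embeds(1)[OF ch B X wf] wX u(1)] by simp
    then show False using u by simp
  qed
  moreover have "L w \<notin> {i. label_rel (g B) (L w) i}" using label_rel_irrefl[OF U] by simp
  ultimately show ?thesis using e insert_ident by metis
qed

lemma block_setD:
  assumes wf: "wf_graph G" and SG: "S \<subseteq> verts G" and B: "B \<in> block_set G S"
  shows "B \<subseteq> S" "bicon (adj G) B" "\<exists>x\<in>B. \<exists>y\<in>B. adj G x y"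
proof -
  have b: "B \<in> blocks (induced G S)" and c: "card B \<ge> 2" using B by (auto simp: block_set_def)
  note wfS = wf_induced[OF wf, of S]
  show BS: "B \<subseteq> S" using block_verts[OF wfS b] by (auto simp: verts_induced)
  have "con (within (adj G) S) A \<longleftrightarrow> con (adj G) A" if "A \<subseteq> S" for A
    using that by (simp add: con_def within_within Int_absorb1)
  then show "bicon (adj G) B"
    using block_bicon[OF wfS b] BS unfolding bicon_def adj_induced by (metis Diff_subset subset_trans)
  obtain x where x: "x \<in> B" using block_nonempty[OF wfS b] by blast
  have "B \<noteq> {x}" using c by auto
  then obtain y where "y \<in> B" "x \<noteq> y" using x by blast
  then show "\<exists>x\<in>B. \<exists>y\<in>B. adj G x y"
    using block_neighbour[OF wfS b x, of y] x by (auto simp: adj_induced within_def)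
qed

lemma S_edge_block_set:
  assumes wf: "wf_graph G" and xy: "adj G x y" "x \<in> S" "y \<in> S"
  obtains B where "B \<in> block_set G S" "x \<in> B" "y \<in> B"
proof -
  note wfS = wf_induced[OF wf, of S]
  have "adj (induced G S) x y" using xy by (simp add: adj_induced within_def)
  then obtain B where B: "B \<in> blocks (induced G S)" "x \<in> B" "y \<in> B" using edge_in_block[OF wfS] by blast
  have "finite B" using block_verts[OF wfS B(1)] finite_verts[OF wfS] finite_subset by blast
  moreover have "{x, y} \<subseteq> B" "card {x, y} = 2" using B xy by (auto simp: adj_def)
  ultimately have "card B \<ge> 2" using card_mono by metis
  then show thesis using B that by (simp add: block_set_def)
qed

section \<open>Exchanging G1 for G2\<close>

text \<open>\<open>M\<close> is the sum known to respect the characteristic and \<open>K\<close> the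
  one under study. They share \<open>H\<close>; between \<open>G1\<close> and \<open>G2\<close> only
  the characteristic mediates.\<close>

locale exchange = M: glued G1 H S + K: glued G2 H S
  for G1 G2 H :: "'v graph" and S :: "'v set" +
  fixes P :: "'v graph set" and d :: nat and L1 L2 LH :: "'v \<Rightarrow> nat"
    and g :: "'v set \<Rightarrow> 'v graph \<times> ('v \<Rightarrow> nat)" and h :: "'v set \<Rightarrow> nat set"
  assumes chordal: "\<forall>G\<in>P. chordal G"
    and PG2: "P_block_graph P G2" and PH: "P_block_graph P H"
    and L1S: "\<forall>v\<in>S. L1 v = LH v" and L2S: "\<forall>v\<in>S. L2 v = LH v"
    and ch1: "characteristic d P G1 L1 S g h" and ch2: "characteristic d P G2 L2 S g h"
    and forest: "\<not> has_cycle (aux_sum G2 H S)"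
    and PM: "P_block_graph P (gsum G1 H)"
    and resp: "respects_char G1 L1 S g H LH"
begin

abbreviation "M \<equiv> gsum G1 H"
abbreviation "K \<equiv> gsum G2 H"
abbreviation "LM \<equiv> lsum G1 L1 LH"
abbreviation "LK \<equiv> lsum G2 L2 LH"
abbreviation "BS \<equiv> block_set G2 S"

lemma BS_G1: "BS = block_set G1 S" and BS_H: "BS = block_set H S"
  using M.eq K.eq by (simp_all add: block_set_def)

lemma LK_G2: "v \<in> verts G2 \<Longrightarrow> LK v = L2 v" by (simp add: lsum_def)
lemma LK_H: "v \<in> verts H \<Longrightarrow> LK v = LH v" using K.verts_Int L2S by (auto simp: lsum_def)
lemma LM_G1: "v \<in> verts G1 \<Longrightarrow> LM v = L1 v" by (simp add: lsum_def)
lemma LM_H: "v \<in> verts H \<Longrightarrow> LM v = LH v" using M.verts_Int L1S by (auto simp: lsum_def)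

text \<open>For \<open>K\<close> the property comes from the forest, whereas for \<open>M\<close> it
  comes from the chordality of its blocks.\<close>

lemma acyclic2_K: "acyclic2 (adj K)"
  using K.acyclic2_gsum[OF P_block_graph_acyclic2[OF PG2 chordal] P_block_graph_acyclic2[OF PH chordal] forest] .

lemma acyclic2_M: "acyclic2 (adj M)"
  by (rule P_block_graph_acyclic2[OF PM chordal])

lemma flipM: "glued H G1 S" and flipK: "glued H G2 S"
  using M.flip K.flip .

lemma adj_K_H: "adj K x y \<Longrightarrow> x \<in> verts H \<Longrightarrow> y \<in> verts H \<Longrightarrow> adj H x y"
  using glued.adj_K_G[OF flipK, of x y] unfolding gsum_commute[of H] .

lemma adj_M_H: "adj M x y \<Longrightarrow> x \<in> verts H \<Longrightarrow> y \<in> verts H \<Longrightarrow> adj H x y"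
  using glued.adj_K_G[OF flipM, of x y] unfolding gsum_commute[of H] .

lemma BSD:
  assumes "B \<in> BS"
  shows "B \<subseteq> S" "bicon (adj G2) B" "bicon (adj G1) B" "bicon (adj H) B" "B \<noteq> {}"
    "\<exists>x\<in>B. \<exists>y\<in>B. x \<noteq> y \<and> adj G2 x y"
proof -
  note B1 = assms[unfolded BS_G1] and BH = assms[unfolded BS_H]
  show "B \<subseteq> S" "bicon (adj G2) B" by (fact block_setD[OF K.wfG K.SG assms])+
  show "bicon (adj G1) B" by (fact block_setD(2)[OF M.wfG M.SG B1])
  show "bicon (adj H) B" by (fact block_setD(2)[OF K.wfH K.SH BH])
  obtain x y where xy: "x \<in> B" "y \<in> B" "adj G2 x y" using block_setD(3)[OF K.wfG K.SG assms] by blast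
  then have "x \<noteq> y" by auto
  then show "\<exists>x\<in>B. \<exists>y\<in>B. x \<noteq> y \<and> adj G2 x y" "B \<noteq> {}" using xy by blast+
qed

lemma BS_blocks:
  assumes "B \<in> BS"
  obtains Y Y' Z W where "Y \<in> blocks G2" "B \<subseteq> Y" "Y' \<in> blocks H" "B \<subseteq> Y'" "Z \<in> blocks G1" "B \<subseteq> Z"
    "W \<in> blocks M" "B \<subseteq> W"
proof -
  note b = BSD[OF assms]
  have v: "B \<subseteq> verts G2" "B \<subseteq> verts H" "B \<subseteq> verts G1" using b(1) K.SG K.SH M.SG by auto
  obtain Y where "Y \<in> blocks G2" "B \<subseteq> Y" using bicon_in_block[OF K.wfG v(1) b(5,2)] by blast
  moreover obtain Y' where "Y' \<in> blocks H" "B \<subseteq> Y'" using bicon_in_block[OF K.wfH v(2) b(5,4)] by blast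
  moreover obtain Z where Z: "Z \<in> blocks G1" "B \<subseteq> Z" using bicon_in_block[OF M.wfG v(3) b(5,3)] by blast
  moreover obtain W where "W \<in> blocks M" "Z \<subseteq> W" using M.part_block[OF Z(1)] by blast
  ultimately show thesis using that by blast
qed

lemma g_U: "B \<in> BS \<Longrightarrow> g B \<in> U d P"
  using ch2 by (simp add: characteristic_def)

lemma M_block_iso:
  assumes W: "W \<in> blocks M" and B: "B \<in> BS" "B \<subseteq> W"
  shows "embeds (adj M) LM W (label_rel (g B)) \<and> LM ` W = labels (g B)"
proof -
  have wf: "wf_graph (fst (g B))" using U_D(2)[OF g_U[OF B(1)]] .
  have "label_iso (induced M W, LM) (g B)"
    using resp W B unfolding respects_char_def BS_G1 by blast
  then have "label_iso (induced M W, LM) (induced (fst (g B)) (verts (fst (g B))), snd (g B))"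
    by (simp add: induced_verts[OF wf])
  note label_iso_embeds[OF g_U[OF B(1)] order_refl this]
  moreover have "verts (induced M W) = W" using block_verts[OF M.wfK W] by (simp add: verts_induced Int_absorb1)
  moreover have "embeds (within (adj M) W) LM W (label_rel (g B)) \<longleftrightarrow> embeds (adj M) LM W (label_rel (g B))"
    by (rule embeds_cong) (auto simp: within_def)
  ultimately show ?thesis by (simp add: adj_induced labels_def)
qed

lemma H_block_in_M_block:
  assumes "Y \<in> blocks H"
  obtains W where "W \<in> blocks M" "Y \<subseteq> W"
  using glued.part_block[OF flipM assms] unfolding gsum_commute[of H G1] by blast

lemma H_block_subset:
  assumes "Y \<in> blocks H" "X \<in> blocks K" "x \<in> X" "x \<in> Y" "y \<in> X" "y \<in> Y" "x \<noteq> y"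
  shows "Y \<subseteq> X"
  using glued.part_block_subset[OF flipK assms(1) _ assms(3-7)] assms(2) unfolding gsum_commute[of H G2] by blast

lemma G2_block_embeds:
  assumes Y: "Y \<in> blocks G2" and B: "B \<in> BS" "B \<subseteq> Y"
  shows "embeds (adj K) LK Y (label_rel (g B)) \<and> LK ` Y \<subseteq> labels (g B)"
proof -
  have v: "\<And>x. x \<in> Y \<Longrightarrow> x \<in> verts G2" using block_verts[OF K.wfG Y] by blast
  have "embeds (adj K) LK Y (label_rel (g B)) \<longleftrightarrow> embeds (adj G2) L2 Y (label_rel (g B))"
    by (rule embeds_cong) (use v LK_G2 K.adj_K_G K.adjG in blast)+
  moreover have "LK ` Y = L2 ` Y" by (rule image_cong) (use v LK_G2 in auto)
  ultimately show ?thesis using characteristic_embeds[OF ch2 B(1) Y B(2) K.wfG] by simp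
qed

text \<open>The characteristic says nothing about blocks of \<open>H\<close>, but each lies in a
  block of \<open>M\<close>, which is label-isomorphic to \<open>g B\<close>.\<close>

lemma H_block_embeds:
  assumes Y: "Y \<in> blocks H" and B: "B \<in> BS" "B \<subseteq> Y"
  shows "embeds (adj K) LK Y (label_rel (g B)) \<and> LK ` Y \<subseteq> labels (g B)"
proof -
  obtain W where W: "W \<in> blocks M" "Y \<subseteq> W" using H_block_in_M_block[OF Y] .
  then have BW: "B \<subseteq> W" using B by blast
  have v: "\<And>x. x \<in> Y \<Longrightarrow> x \<in> verts H" using block_verts[OF K.wfH Y] by blast
  have "embeds (adj K) LK Y (label_rel (g B)) \<longleftrightarrow> embeds (adj M) LM Y (label_rel (g B))"
  proof (rule embeds_cong)
    fix u v assume "u \<in> Y" "v \<in> Y"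
    then have "u \<in> verts H" "v \<in> verts H" using v by auto
    then show "adj K u v \<longleftrightarrow> adj M u v"
      using adj_K_H[of u v] adj_M_H[of u v] K.adjH[of u v] M.adjH[of u v] by argo
  qed (use v LK_H LM_H in simp)
  moreover have "LK ` Y = LM ` Y" by (rule image_cong) (use v LK_H LM_H in auto)
  moreover have "embeds (adj M) LM Y (label_rel (g B))"
    using M_block_iso[OF W(1) B(1) BW] embeds_subset[OF _ W(2)] by blast
  ultimately show ?thesis using M_block_iso[OF W(1) B(1) BW] image_mono[OF W(2), of LM] by simp
qed

lemma part_embeds:
  "Y \<in> blocks G2 \<or> Y \<in> blocks H \<Longrightarrow> B \<in> BS \<Longrightarrow> B \<subseteq> Y \<Longrightarrow>
    embeds (adj K) LK Y (label_rel (g B)) \<and> LK ` Y \<subseteq> labels (g B)"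
  using G2_block_embeds H_block_embeds by blast

text \<open>In \<open>G2\<close> this is condition (b). In \<open>H\<close> both relations are read
  off the same block \<open>W\<close> of \<open>M\<close>; that determines \<open>g B\<close> only
  up to label-isomorphism, hence the statement about \<open>label_rel\<close>.\<close>

lemma label_rel_const:
  assumes Y: "Y \<in> blocks G2 \<or> Y \<in> blocks H" and B: "B \<in> BS" "B \<subseteq> Y" "B' \<in> BS" "B' \<subseteq> Y"
  shows "label_rel (g B) = label_rel (g B')"
  using Y
proof
  assume y: "Y \<in> blocks G2"
  show ?thesis using characteristicD(3)[OF ch2 B(1) y B(2), rule_format, OF B(3,4)] by simp
next
  assume "Y \<in> blocks H"
  then obtain W where W: "W \<in> blocks M" "Y \<subseteq> W" by (rule H_block_in_M_block)
  have char: "label_rel (g B) i j \<longleftrightarrow> (\<exists>u\<in>W. \<exists>v\<in>W. adj M u v \<and> LM u = i \<and> LM v = j)"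
    if "B \<in> BS" "B \<subseteq> Y" for B i j
  proof -
    have e: "embeds (adj M) LM W (label_rel (g B))" "LM ` W = labels (g B)"
      using M_block_iso[OF W(1) that(1)] that(2) W(2) by blast+
    show ?thesis
    proof
      assume l: "label_rel (g B) i j"
      have "i \<in> LM ` W" "j \<in> LM ` W" using label_rel_labels[OF l] e(2) by simp_all
      then obtain u v where uv: "u \<in> W" "v \<in> W" "LM u = i" "LM v = j" by blast
      then have "adj M u v" using l embedsD(1)[OF e(1) uv(1,2)] by simp
      then show "\<exists>u\<in>W. \<exists>v\<in>W. adj M u v \<and> LM u = i \<and> LM v = j" using uv by blast
    next
      assume "\<exists>u\<in>W. \<exists>v\<in>W. adj M u v \<and> LM u = i \<and> LM v = j"
      then show "label_rel (g B) i j" using embedsD(1)[OF e(1)] by blast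
    qed
  qed
  show ?thesis using char[OF B(1,2)] char[OF B(3,4)] by (intro ext) simp
qed

end

section \<open>A block of K containing a member of Block(G2,S)\<close>

locale exchange_block = exchange G1 G2 H S P d L1 L2 LH g h
  for G1 G2 H :: "'v graph" and S P d L1 L2 LH g h +
  fixes X B0 :: "'v set"
  assumes X: "X \<in> blocks K" and B0: "B0 \<in> BS" "B0 \<subseteq> X"
begin

abbreviation "s \<equiv> label_rel (g B0)"

lemma symp_s: "symp s" and irrefl_s: "\<not> s i i" and hole_free_s: "hole_free s" and bicon_s: "bicon s (labels (g B0))"
  by (fact symp_label_rel label_rel_irrefl[OF g_U[OF B0(1)]] label_rel_hole_free[OF g_U[OF B0(1)] chordal]
    label_rel_bicon[OF g_U[OF B0(1)]])+

text \<open>The graph \<open>J\<close> is a parameter because an edge inside \<open>S\<close> lies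
  in a block of \<open>G2\<close> and in one of \<open>H\<close>.\<close>

definition good :: "'v graph \<Rightarrow> 'v \<Rightarrow> 'v \<Rightarrow> bool" where
  "good J x y \<longleftrightarrow> (\<exists>Y B. Y \<in> blocks J \<and> x \<in> Y \<and> y \<in> Y \<and> B \<in> BS \<and> B \<subseteq> Y \<and> label_rel (g B) = s)"

lemma good_sym: "good J x y \<Longrightarrow> good J y x"
  by (auto simp: good_def)

text \<open>An edge of both parts lies inside \<open>S\<close>, hence in some \<open>B'\<close> of
  \<open>BS\<close>. This \<open>B'\<close> is contained in the block \<open>Y\<close> of one part
  and in a block of the other, and carries \<open>s\<close> across.\<close>

lemma good_transfer:
  assumes J: "J \<in> {G2, H}" "J' \<in> {G2, H}" and gd: "good J x y" and a: "adj J x y" "adj J' x y"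
  shows "good J' x y"
proof (cases "J = J'")
  case False
  then have xy: "adj G2 x y" "adj H x y" using J a by auto
  then have "x \<in> S" "y \<in> S" using K.adj_both by auto
  then obtain B' where B': "B' \<in> BS" "x \<in> B'" "y \<in> B'" using S_edge_block_set[OF K.wfG xy(1)] by blast
  obtain Y B where Y: "Y \<in> blocks J" "x \<in> Y" "y \<in> Y" "B \<in> BS" "B \<subseteq> Y" "label_rel (g B) = s"
    using gd unfolding good_def by blast
  have wfJ: "wf_graph J" and bJ: "bicon (adj J) B'" and vJ: "B' \<subseteq> verts J"
    using J(1) K.wfG K.wfH BSD[OF B'(1)] K.SG K.SH by auto
  have "x \<noteq> y" using xy(1) by auto
  then have sub: "B' \<subseteq> Y" using block_absorb[OF wfJ Y(1) vJ bJ Y(2) B'(2) Y(3) B'(3)] by blast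
  have s: "label_rel (g B') = s" using label_rel_const[of Y B B'] Y B' sub J(1) by auto
  obtain Y2 Y3 where "Y2 \<in> blocks G2" "B' \<subseteq> Y2" "Y3 \<in> blocks H" "B' \<subseteq> Y3" using BS_blocks[OF B'(1)] by metis
  then show ?thesis using J(2) B' s unfolding good_def by blast
qed (use gd in simp)

lemma good_step:
  assumes J: "J \<in> {G2, H}" and gd: "good J x y" and a: "adj J x y" "adj J x z" "adj J y z"
  shows "good J x z"
proof -
  obtain Y B where Y: "Y \<in> blocks J" "x \<in> Y" "y \<in> Y" "B \<in> BS" "B \<subseteq> Y" "label_rel (g B) = s"
    using gd unfolding good_def by blast
  have wfJ: "wf_graph J" using J K.wfG K.wfH by auto
  have "z \<in> Y" using block_triangle[OF wfJ Y(1,2,3) a(1,3,2)] .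
  then show ?thesis using Y unfolding good_def by blast
qed

lemma all_good:
  assumes "x \<in> X" "y \<in> X" "J \<in> {G2, H}" "adj J x y"
  shows "good J x y"
proof -
  \<comment> \<open>The invariant covers both parts at once, since the next triangle may lie in
    another part than the one where the edge was shown to be good.\<close>
  let ?R = "\<lambda>x y. \<forall>J\<in>{G2, H}. adj J x y \<longrightarrow> good J x y"
  obtain x0 y0 where xy0: "x0 \<in> B0" "y0 \<in> B0" "adj G2 x0 y0" using BSD(6)[OF B0(1)] by blast
  obtain Y2 Y3 where Y: "Y2 \<in> blocks G2" "B0 \<subseteq> Y2" "Y3 \<in> blocks H" "B0 \<subseteq> Y3" using BS_blocks[OF B0(1)] by metis
  have "?R x y"
  proof (rule block_edge_induct[where R = ?R, OF K.wfK acyclic2_K X])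
    show "x0 \<in> X" "y0 \<in> X" "adj K x0 y0" using xy0 B0 K.adjG by auto
    show "?R x0 y0" using Y xy0 B0(1) unfolding good_def by blast
    show "?R y x" if "?R x y" for x y using that good_sym adj_sym by metis
    show "x \<in> X" "y \<in> X" by fact+
    show "adj K x y" using assms(3,4) K.adjG K.adjH by blast
    fix x y z
    assume t: "adj K x y" "adj K x z" "adj K y z" and R: "?R x y"
    show "?R x z"
    proof (intro ballI impI)
      fix J' assume J': "J' \<in> {G2, H}" "adj J' x z"
      obtain J where J: "J \<in> {G2, H}" "adj J x y" "adj J x z" "adj J y z"
        using K.triangle_part[OF t] by blast
      then have "good J x z" using good_step R by blast
      then show "good J' x z" using good_transfer J J' by blast
    qed
  qed
  then show ?thesis using assms by blast
qed

lemma X_edge_good: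
  assumes "x \<in> X" "y \<in> X" "adj K x y"
  obtains J Y B where "J \<in> {G2, H}" "adj J x y" "Y \<in> blocks J" "x \<in> Y" "y \<in> Y" "B \<in> BS" "B \<subseteq> Y"
    "label_rel (g B) = s" "Y \<subseteq> X"
proof -
  obtain J where J: "J \<in> {G2, H}" "adj J x y" using assms(3) unfolding adj_gsum by blast
  then obtain Y B where Y: "Y \<in> blocks J" "x \<in> Y" "y \<in> Y" "B \<in> BS" "B \<subseteq> Y" "label_rel (g B) = s"
    using all_good[OF assms(1,2)] unfolding good_def by blast
  have "x \<noteq> y" using J(2) by auto
  then have "Y \<subseteq> X"
    using J(1) Y K.part_block_subset[OF _ X assms(1) _ assms(2), of Y] H_block_subset[OF _ X assms(1) _ assms(2), of Y] by auto
  then show thesis using that J Y by blast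
qed

lemma X_hom:
  assumes "x \<in> X" "y \<in> X" "adj K x y"
  shows "s (LK x) (LK y)"
proof -
  obtain J Y B where J: "J \<in> {G2, H}" "Y \<in> blocks J" "x \<in> Y" "y \<in> Y" "B \<in> BS" "B \<subseteq> Y" "label_rel (g B) = s"
    using X_edge_good[OF assms] by metis
  then have "embeds (adj K) LK Y s" using part_embeds[of Y B] by auto
  then show ?thesis using embedsD(1)[OF _ J(3,4)] assms(3) by blast
qed

text \<open>The premises \<open>loc\<close> and \<open>img\<close> of \<open>cover_iso\<close> at
  \<open>w\<close>, for the whole block \<open>X\<close>.\<close>

definition star :: "'v \<Rightarrow> bool" where
  "star w \<longleftrightarrow> embeds (adj K) LK {u \<in> X. adj K w u} s \<and> LK ` {u \<in> X. adj K w u} = {i. s (LK w) i}"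

text \<open>Triangles at \<open>w\<close> cannot change the part, so connectedness of the link
  confines the neighbourhood of \<open>w\<close> to one block \<open>Y\<close> of one part. In
  \<open>G2\<close> condition (d) describes it. In \<open>H\<close> the same confinement takes place
  in \<open>M\<close>, whose block is fully known.\<close>

lemma star_no_S_edge:
  assumes wX: "w \<in> X" and a: "a \<in> X" "adj K w a"
    and noS: "\<And>u. u \<in> X \<Longrightarrow> adj K w u \<Longrightarrow> w \<in> S \<Longrightarrow> u \<notin> S"
  shows "star w"
proof -
  obtain J Y B where J: "J \<in> {G2, H}" and wa: "adj J w a" and Y: "Y \<in> blocks J" "w \<in> Y" "a \<in> Y"
    and B: "B \<in> BS" "B \<subseteq> Y" "label_rel (g B) = s" and YX: "Y \<subseteq> X"
    by (rule X_edge_good[OF wX a])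
  have wfJ: "wf_graph J" using J K.wfG K.wfH by auto
  have JK: "adj K x y" if "adj J x y" for x y using J that K.adjG K.adjH by auto
  have N: "{u \<in> X. adj K w u} = {u \<in> Y. adj J w u}"
  proof
    show "{u \<in> Y. adj J w u} \<subseteq> {u \<in> X. adj K w u}" using YX JK by blast
    show "{u \<in> X. adj K w u} \<subseteq> {u \<in> Y. adj J w u}"
    proof
      fix u assume "u \<in> {u \<in> X. adj K w u}"
      then have "(link (adj K) w)\<^sup>*\<^sup>* a u"
        using block_link[OF K.wfK acyclic2_K X wX a(1) _ a(2)] by simp
      then show "u \<in> {u \<in> Y. adj J w u}"
      proof induction
        case (step y z)
        then have y: "y \<in> Y" "adj J w y" and t: "adj K w y" "adj K w z" "adj K y z"
          by (auto simp: link_def within_def)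
        obtain J' where J': "J' \<in> {G2, H}" "adj J' w y" "adj J' w z" "adj J' y z"
          using K.triangle_part[OF t] by blast
        \<comment> \<open>A triangle of the other part would put the edge from \<open>w\<close> to
          \<open>y\<close> into both parts, hence inside \<open>S\<close>.\<close>
        have "J' = J"
        proof (rule ccontr)
          assume "J' \<noteq> J"
          then have "adj G2 w y" "adj H w y" using J J' y by auto
          then have "w \<in> S" "y \<in> S" using K.adj_both by auto
          then show False using noS[of y] t(1) y(1) YX by blast
        qed
        then show ?case using block_triangle[OF wfJ Y(1,2) y(1,2)] J' by auto
      qed (use Y wa in simp)
    qed
  qed
  have emb: "embeds (adj K) LK {u \<in> X. adj K w u} s"
    unfolding N using part_embeds[OF _ B(1,2)] Y(1) J B(3) embeds_subset[of "adj K" LK Y s] by auto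
  from J consider "J = G2" | "J = H" by blast
  then have "LK ` {u \<in> X. adj K w u} = {i. s (LK w) i}"
  proof cases
    case 1
    note Y = Y[unfolded 1]
    have "w \<in> Y - S \<or> (\<exists>C\<in>components (induced G2 S). Y \<inter> C = {w})"
    proof (cases "w \<in> S")
      case wS: True
      let ?T = "adj (induced G2 S)" and ?C = "component_of (adj (induced G2 S)) w"
      have "?C \<in> components (induced G2 S)"
        using component_of_components[OF wf_induced[OF K.wfG]] wS K.SG by (simp add: verts_induced subset_iff)
      moreover have "w' = w" if w': "w' \<in> Y" "w' \<in> ?C" for w'
      proof (rule ccontr)
        assume ne: "w' \<noteq> w"
        have "?T\<^sup>*\<^sup>* w w'" using w'(2) by (simp add: component_of_def)
        \<comment> \<open>Leave \<open>w\<close> for the last time on the way to \<open>w'\<close>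
          through \<open>S\<close>, and go on from \<open>w'\<close> to \<open>a\<close> inside
          \<open>Y\<close> without \<open>w\<close>. This joins \<open>u\<close> to \<open>a\<close>
          off \<open>w\<close>, so the link puts \<open>u\<close> into \<open>X\<close>, against
          \<open>noS\<close>.\<close>
        then obtain u where u: "?T w u" "(within ?T (- {w}))\<^sup>*\<^sup>* u w'"
          using rtranclp_first_step[of ?T w w'] ne by blast
        have "adj G2 w u" "u \<in> S" using u(1) by (auto simp: adj_induced within_def)
        have wu: "adj K w u" using K.adjG[OF \<open>adj G2 w u\<close>] .
        have "(within (adj K) (- {w}))\<^sup>*\<^sup>* u w'"
          by (rule rtranclp_subrel[OF _ u(2)]) (auto simp: within_def adj_induced K.adjG)
        then have 1: "(within (adj K) (- {w}))\<^sup>*\<^sup>* w' u"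
          by (rule rtranclp_sym[OF within_symp[OF symp_adj]])
        have "con (adj G2) (Y - {w})" using block_bicon[OF K.wfG Y(1)] Y(2) by (simp add: bicon_def)
        moreover have "a \<in> Y - {w}" "w' \<in> Y - {w}" using Y(3) w'(1) ne wa by auto
        ultimately have "(within (adj G2) (Y - {w}))\<^sup>*\<^sup>* a w'" by (simp add: con_def)
        then have "(within (adj K) (- {w}))\<^sup>*\<^sup>* a w'"
          by (rule rtranclp_subrel[rotated]) (auto simp: within_def K.adjG)
        then have "(within (adj K) (- {w}))\<^sup>*\<^sup>* a u" using 1 by (rule rtranclp_trans)
        then have "(link (adj K) w)\<^sup>*\<^sup>* a u"
          by (rule link_connected[OF symp_adj adj_irrefl acyclic2_K a(2) wu])
        then have "u \<in> X" using link_in_block[OF K.wfK X wX a] by blast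
        then show False using noS wu wS \<open>u \<in> S\<close> by blast
      qed
      ultimately show ?thesis using Y(2) component_of_self[of w ?T] by blast
    qed (use Y in blast)
    then have "L2 ` {u \<in> Y. adj G2 w u} = {i. s (L2 w) i}"
      using characteristic_star[OF ch2 B(1) Y(1) B(2) K.wfG Y(2)] B(3) by simp
    moreover have "LK x = L2 x" if "x \<in> Y" for x using LK_G2 block_verts[OF K.wfG Y(1)] that by blast
    ultimately show ?thesis unfolding N 1 using Y(2) by simp
  next
    case 2
    note Y = Y[unfolded 2]
    obtain W where W: "W \<in> blocks M" "Y \<subseteq> W" by (rule H_block_in_M_block[OF Y(1)])
    have BW: "B \<subseteq> W" using B W by blast
    have e: "embeds (adj M) LM W s" "LM ` W = labels (g B)" using M_block_iso[OF W(1) B(1) BW] B(3) by auto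
    have wW: "w \<in> W" "a \<in> W" "adj M w a" using Y W M.adjH wa 2 by auto
    \<comment> \<open>The link of \<open>w\<close> in \<open>M\<close> stays in \<open>H\<close> for
      the same reason: an edge of \<open>G1\<close> from \<open>w\<close> into \<open>Y\<close>
      would lie inside \<open>S\<close>.\<close>
    have "{u \<in> W. adj M w u} = {u \<in> Y. adj H w u}"
    proof
      show "{u \<in> Y. adj H w u} \<subseteq> {u \<in> W. adj M w u}" using W M.adjH by blast
      show "{u \<in> W. adj M w u} \<subseteq> {u \<in> Y. adj H w u}"
      proof
        fix u assume "u \<in> {u \<in> W. adj M w u}"
        then have "(link (adj M) w)\<^sup>*\<^sup>* a u"
          using block_link[OF M.wfK acyclic2_M W(1) wW(1,2) _ wW(3)] by simp
        then show "u \<in> {u \<in> Y. adj H w u}"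
        proof induction
          case (step y z)
          then have y: "y \<in> Y" "adj H w y" and t: "adj M w y" "adj M w z" "adj M y z"
            by (auto simp: link_def within_def)
          have "\<not> adj G1 w y"
          proof
            assume "adj G1 w y"
            then have "w \<in> S" "y \<in> S" using M.adj_both y by auto
            then show False using noS[of y] y YX K.adjH by blast
          qed
          then have "adj H w z" "adj H y z" using M.triangle_part[OF t] by auto
          then show ?case using block_triangle[OF K.wfH Y(1,2) y] by auto
        qed (use Y wa 2 in simp)
      qed
    qed
    moreover have "LM ` {u \<in> W. adj M w u} = {i. s (LM w) i}"
    proof
      show "LM ` {u \<in> W. adj M w u} \<subseteq> {i. s (LM w) i}" using embedsD(1)[OF e(1) wW(1)] by blast
      show "{i. s (LM w) i} \<subseteq> LM ` {u \<in> W. adj M w u}"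
      proof
        fix i assume i: "i \<in> {i. s (LM w) i}"
        then have "i \<in> LM ` W" using label_rel_labels[of "g B" "LM w" i] e(2) B(3) by simp
        then obtain u where u: "u \<in> W" "LM u = i" by blast
        then have "adj M w u" using embedsD(1)[OF e(1) wW(1) u(1)] i by simp
        then show "i \<in> LM ` {u \<in> W. adj M w u}" using u by blast
      qed
    qed
    moreover have "LK x = LM x" if "x \<in> Y" for x
    proof -
      have "x \<in> verts H" using block_verts[OF K.wfH Y(1)] that by blast
      then show ?thesis using LK_H LM_H by simp
    qed
    ultimately show ?thesis unfolding N 2 using Y(2) by simp
  qed
  then show ?thesis using emb by (simp add: star_def)
qed

text \<open>As \<open>u\<close> is outside \<open>S\<close>, its whole neighbourhood is described by
  \<open>star_no_S_edge\<close>. It contains \<open>w\<close>, and its embedding tells which of its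
  members are adjacent to \<open>w\<close>.\<close>

lemma common_neighbours_outside:
  assumes X': "w \<in> X" "u \<in> X" "adj K w u" and uS: "u \<notin> S"
  shows "embeds (adj K) LK {v \<in> X. adj K w v \<and> adj K u v} s \<and>
    LK ` {v \<in> X. adj K w v \<and> adj K u v} = {i. s (LK w) i \<and> s (LK u) i}"
proof -
  have uw: "adj K u w" using adj_sym[OF X'(3)] .
  have st: "star u" by (rule star_no_S_edge[OF X'(2,1) uw]) (use uS in blast)
  then have e: "embeds (adj K) LK {v \<in> X. adj K u v} s" and im: "LK ` {v \<in> X. adj K u v} = {i. s (LK u) i}"
    by (auto simp: star_def)
  have "{i. s (LK w) i \<and> s (LK u) i} \<subseteq> LK ` {v \<in> X. adj K w v \<and> adj K u v}"
  proof
    fix i assume i: "i \<in> {i. s (LK w) i \<and> s (LK u) i}"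
    then have "i \<in> LK ` {v \<in> X. adj K u v}" using im by simp
    then obtain v where v: "v \<in> X" "adj K u v" "LK v = i" by blast
    then have "adj K w v" using embedsD(1)[OF e, of w v] X' uw i by simp
    then show "i \<in> LK ` {v \<in> X. adj K w v \<and> adj K u v}" using v by blast
  qed
  moreover have "LK ` {v \<in> X. adj K w v \<and> adj K u v} \<subseteq> {i. s (LK w) i \<and> s (LK u) i}"
    using X_hom X' by blast
  moreover have "embeds (adj K) LK {v \<in> X. adj K w v \<and> adj K u v} s"
    by (rule embeds_subset[OF e]) blast
  ultimately show ?thesis by blast
qed

text \<open>At an edge of \<open>G[S]\<close> the labels on the \<open>G2\<close>-side and on the \<open>G1\<close>-side of the
  common neighbourhood agree by condition (c), so \<open>G1 + H\<close> serves as a model for \<open>K\<close>.\<close>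
lemma common_neighbours_S_edge:
  assumes X': "w \<in> X" "u \<in> X" "adj K w u" and wS: "w \<in> S" and uS: "u \<in> S"
  shows "embeds (adj K) LK {v \<in> X. adj K w v \<and> adj K u v} s \<and>
    LK ` {v \<in> X. adj K w v \<and> adj K u v} = {i. s (LK w) i \<and> s (LK u) i}"
proof -
  let ?C = "{v \<in> X. adj K w v \<and> adj K u v}"
  have wu2: "adj G2 w u" using X'(3) K.adj_K_G wS uS K.SG by blast
  have wuH: "adj H w u" using K.adj_S[OF wS uS] wu2 by simp
  have wu1: "adj G1 w u" using M.adj_S[OF wS uS] wuH by simp
  have ne: "w \<noteq> u" using wu2 by auto
  obtain B where B: "B \<in> BS" "w \<in> B" "u \<in> B" by (rule S_edge_block_set[OF K.wfG wu2 wS uS])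
  have BS': "B \<subseteq> S" using BSD(1)[OF B(1)] .
  obtain Y Y' Z W where Y: "Y \<in> blocks G2" "B \<subseteq> Y" and Y': "Y' \<in> blocks H" "B \<subseteq> Y'"
    and Z: "Z \<in> blocks G1" "B \<subseteq> Z" and W: "W \<in> blocks M" "B \<subseteq> W"
    by (rule BS_blocks[OF B(1)])
  have mem: "w \<in> Y" "u \<in> Y" "w \<in> Y'" "u \<in> Y'" "w \<in> Z" "u \<in> Z" "w \<in> W" "u \<in> W"
    using B Y Y' Z W by auto
  have YX: "Y \<subseteq> X" by (rule K.part_block_subset[OF Y(1) X X'(1) mem(1) X'(2) mem(2) ne])
  have Y'X: "Y' \<subseteq> X" by (rule H_block_subset[OF Y'(1) X X'(1) mem(3) X'(2) mem(4) ne])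
  have ZW: "Z \<subseteq> W" by (rule M.part_block_subset[OF Z(1) W(1) mem(7,5,8,6) ne])
  have Y'W: "Y' \<subseteq> W"
    using glued.part_block_subset[OF flipM Y'(1) _ mem(7,3,8,4) ne] W(1) unfolding gsum_commute[of H G1] by blast
  have sB: "label_rel (g B) = s"
  proof -
    obtain Y1 B1 where 1: "Y1 \<in> blocks G2" "w \<in> Y1" "u \<in> Y1" "B1 \<in> BS" "B1 \<subseteq> Y1" "label_rel (g B1) = s"
      using all_good[OF X'(1,2) _ wu2] unfolding good_def by blast
    have "B \<subseteq> Y1"
      using block_absorb[OF K.wfG 1(1) _ BSD(2)[OF B(1)] 1(2) B(2) 1(3) B(3) ne] BS' K.SG by blast
    then show ?thesis using label_rel_const[of Y1 B B1] 1 B(1) by simp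
  qed
  have e1: "embeds (adj K) LK Y s" using G2_block_embeds[OF Y(1) B(1) Y(2)] sB by simp
  have e2: "embeds (adj K) LK Y' s" using H_block_embeds[OF Y'(1) B(1) Y'(2)] sB by simp
  have e3: "embeds (adj M) LM W s" and i3: "LM ` W = labels (g B)"
    using M_block_iso[OF W(1) B(1) W(2)] sB by simp_all
  have vY: "x \<in> Y \<Longrightarrow> x \<in> verts G2" and vY': "x \<in> Y' \<Longrightarrow> x \<in> verts H" and vZ: "x \<in> Z \<Longrightarrow> x \<in> verts G1" for x
    using block_verts[OF K.wfG Y(1)] block_verts[OF K.wfH Y'(1)] block_verts[OF M.wfG Z(1)] by auto
  have Lw: "LM w = LK w" "LM u = LK u" using vY'[OF mem(3)] vY'[OF mem(4)] LM_H LK_H by auto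
  have ha: "L2 ` (nbhd_in G2 Y B - S) = L1 ` (nbhd_in G1 Z B - S)"
    using characteristicD(4)[OF ch2 B(1) Y] characteristicD(4)[OF ch1 B(1)[unfolded BS_G1] Z] by simp
  have C: "v \<in> Y \<and> v \<in> Y' \<or> v \<in> Y - S \<or> v \<in> Y' - S" if v: "v \<in> ?C" for v
  proof -
    from v have "adj K w u" "adj K w v" "adj K u v" using X' by auto
    from K.triangle_part[OF this] show ?thesis
    proof
      assume t: "adj G2 w u \<and> adj G2 w v \<and> adj G2 u v"
      then have vY: "v \<in> Y" using block_triangle[OF K.wfG Y(1) mem(1,2)] by blast
      show ?thesis
      proof (cases "v \<in> S")
        case True
        then have "adj H w v" "adj H u v" using K.adj_S t wS uS by auto
        then show ?thesis using block_triangle[OF K.wfH Y'(1) mem(3,4) wuH] vY by blast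
      qed (use vY in blast)
    next
      assume t: "adj H w u \<and> adj H w v \<and> adj H u v"
      then have vY': "v \<in> Y'" using block_triangle[OF K.wfH Y'(1) mem(3,4)] by blast
      show ?thesis
      proof (cases "v \<in> S")
        case True
        then have "adj G2 w v" "adj G2 u v" using K.adj_S t wS uS by auto
        then show ?thesis using block_triangle[OF K.wfG Y(1) mem(1,2) wu2] vY' by blast
      qed (use vY' in blast)
    qed
  qed
  \<comment> \<open>A stand-in for \<open>v\<close> on the \<open>G1\<close> side: its label lies in
    \<open>h B\<close>, which both characteristics share.\<close>
  have model: "\<exists>v1\<in>Z - S. LM v1 = LK v" if v: "v \<in> ?C" "v \<in> Y - S" for v
  proof -
    have "adj G2 w v" using v vY[of v] vY[OF mem(1)] K.adj_K_G by blast
    then have "v \<in> nbhd_in G2 Y B - S" using v B by (auto simp: nbhd_in_def)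
    then have "L2 v \<in> L1 ` (nbhd_in G1 Z B - S)" using ha by blast
    then obtain v1 where v1: "v1 \<in> Z - S" "L1 v1 = L2 v" by (auto simp: nbhd_in_def)
    moreover have "LK v = L2 v" using LK_G2 vY v by blast
    moreover have "LM v1 = L1 v1" using LM_G1 vZ v1(1) by blast
    ultimately show ?thesis by auto
  qed
  \<comment> \<open>These are the pairs that no block of a part contains. In \<open>M\<close> the
    stand-in \<open>v1\<close> and \<open>v'\<close> lie on different sides of \<open>S\<close>, so
    they are distinct and not adjacent, and the embedding of \<open>W\<close> says the same of their
    labels.\<close>
  have cross: "LK v \<noteq> LK v' \<and> \<not> s (LK v) (LK v')" if v: "v \<in> ?C" "v \<in> Y - S" "v' \<in> Y' - S" for v v'
  proof -
    obtain v1 where v1: "v1 \<in> Z - S" "LM v1 = LK v" using model[OF v(1,2)] by blast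
    have L': "LM v' = LK v'" using LM_H LK_H vY' v(3) by auto
    have W': "v1 \<in> W" "v' \<in> W" using v1 ZW v(3) Y'W by auto
    have n: "v' \<notin> verts G1" using M.verts_Int vY' v(3) by blast
    have "v1 \<noteq> v'" using n vZ v1 by blast
    moreover have "\<not> adj M v1 v'"
      using M.adj_K_outside[of v1 v'] adj_verts(2)[OF M.wfG, of v1 v'] vZ v1 n by blast
    ultimately show ?thesis using embedsD[OF e3 W'] v1(2) L' by simp
  qed
  have "embeds (adj K) LK ?C s"
  proof -
    have key: "(adj K v v' \<longleftrightarrow> s (LK v) (LK v')) \<and> (LK v = LK v' \<longleftrightarrow> v = v')" if v: "v \<in> ?C" "v' \<in> ?C" for v v'
    proof -
      have hom: "adj K v v' \<Longrightarrow> s (LK v) (LK v')" using X_hom v by blast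
      consider "v \<in> Y" "v' \<in> Y" | "v \<in> Y'" "v' \<in> Y'" | "v \<in> Y - S" "v' \<in> Y' - S" | "v \<in> Y' - S" "v' \<in> Y - S"
        using C[OF v(1)] C[OF v(2)] by blast
      then show ?thesis
      proof cases
        case 1
        then show ?thesis using embedsD[OF e1] by blast
      next
        case 2
        then show ?thesis using embedsD[OF e2] by blast
      next
        case 3
        then show ?thesis using cross[OF v(1)] hom by metis
      next
        case 4
        then have "LK v' \<noteq> LK v \<and> \<not> s (LK v') (LK v)" using cross[OF v(2)] by blast
        then show ?thesis using hom sympD[OF symp_s] by metis
      qed
    qed
    show ?thesis unfolding embeds_def inj_on_def using key by blast
  qed
  moreover have "LK ` ?C \<subseteq> {i. s (LK w) i \<and> s (LK u) i}" using X_hom X' by blast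
  moreover have "{i. s (LK w) i \<and> s (LK u) i} \<subseteq> LK ` ?C"
  proof
    fix i assume i: "i \<in> {i. s (LK w) i \<and> s (LK u) i}"
    then have "i \<in> LM ` W" using label_rel_labels[of "g B" "LK w" i] i3 sB by simp
    then obtain v1 where v1: "v1 \<in> W" "LM v1 = i" by blast
    have t: "adj M w u" "adj M w v1" "adj M u v1"
      using M.adjG[OF wu1] embedsD(1)[OF e3 mem(7) v1(1)] embedsD(1)[OF e3 mem(8) v1(1)] v1(2) Lw i by simp_all
    have H: "i \<in> LK ` ?C" if h: "adj H w v1" "adj H u v1"
    proof -
      have "v1 \<in> Y'" using block_triangle[OF K.wfH Y'(1) mem(3,4) wuH] h by blast
      moreover have "LK v1 = i" using LK_H LM_H vY'[OF calculation] v1(2) by simp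
      moreover have "adj K w v1" "adj K u v1" using h K.adjH by auto
      ultimately show ?thesis using Y'X by blast
    qed
    from M.triangle_part[OF t] show "i \<in> LK ` ?C"
    proof
      assume g1: "adj G1 w u \<and> adj G1 w v1 \<and> adj G1 u v1"
      show ?thesis
      proof (cases "v1 \<in> S")
        case True
        then show ?thesis using H M.adj_S g1 wS uS by blast
      next
        case False
        have vZ1: "v1 \<in> Z" using block_triangle[OF M.wfG Z(1) mem(5,6) wu1] g1 by blast
        then have "v1 \<in> nbhd_in G1 Z B - S" using g1 B False by (auto simp: nbhd_in_def)
        \<comment> \<open>Condition (c) yields a vertex of \<open>Y\<close> with this label next to
          some vertex of \<open>B\<close>; its adjacency to \<open>w\<close> and \<open>u\<close>
          themselves follows from the embedding of \<open>Y\<close>.\<close>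
        then have "L1 v1 \<in> L2 ` (nbhd_in G2 Y B - S)" using ha by blast
        then obtain v where v: "v \<in> Y" "L2 v = L1 v1" by (auto simp: nbhd_in_def)
        have Lv: "LK v = i" using LK_G2[OF vY[OF v(1)]] LM_G1[OF vZ[OF vZ1]] v(2) v1(2) by simp
        then have "adj K w v" "adj K u v"
          using embedsD(1)[OF e1 mem(1) v(1)] embedsD(1)[OF e1 mem(2) v(1)] i by simp_all
        then show ?thesis using Lv v(1) YX by blast
      qed
    qed (use H in blast)
  qed
  ultimately show ?thesis by blast
qed

text \<open>In the neighbourhood of \<open>w\<close>, the local premises of \<open>cover_iso\<close>
  at \<open>u\<close> concern the common neighbours of \<open>w\<close> and \<open>u\<close>. They
  were settled above, separately for \<open>u\<close> outside and inside \<open>S\<close>.\<close>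

lemma star_all:
  assumes wX: "w \<in> X"
  shows "star w"
proof (cases "\<exists>u\<in>X. adj K w u \<and> w \<in> S \<and> u \<in> S")
  case False
  obtain x y where xy: "x \<in> B0" "y \<in> B0" "x \<noteq> y" using BSD(6)[OF B0(1)] by blast
  then obtain b where "b \<in> X" "b \<noteq> w" using B0(2) by (cases "x = w") auto
  then obtain a where "a \<in> X" "adj K w a" using block_neighbour[OF K.wfK X wX] by blast
  then show ?thesis using star_no_S_edge[OF wX] False by blast
next
  case True
  then obtain u0 where u0: "u0 \<in> X" "adj K w u0" and wS: "w \<in> S" by blast
  let ?N = "{u \<in> X. adj K w u}" and ?V = "{i. s (LK w) i}"
  have cn: "embeds (adj K) LK {v \<in> X. adj K w v \<and> adj K u v} s"
    "LK ` {v \<in> X. adj K w v \<and> adj K u v} = {i. s (LK w) i \<and> s (LK u) i}" if "u \<in> ?N" for u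
    using common_neighbours_outside[OF wX, of u] common_neighbours_S_edge[OF wX, of u] wS that by (cases "u \<in> S"; blast)+
  have "embeds (adj K) LK ?N s \<and> LK ` ?N = ?V"
  proof (rule cover_iso[OF symp_adj symp_s irrefl_s hole_free_s])
    show "con (adj K) ?N"
      unfolding con_def
    proof (intro ballI)
      fix a b assume ab: "a \<in> ?N" "b \<in> ?N"
      then have "(link (adj K) w)\<^sup>*\<^sup>* a b" using block_link[OF K.wfK acyclic2_K X wX] by simp
      then have "(within (adj K) ?N)\<^sup>*\<^sup>* a b \<and> b \<in> ?N"
      proof induction
        case (step y z)
        then have y: "y \<in> X" "adj K w y" "adj K w z" "adj K y z" by (auto simp: link_def within_def)
        then have "z \<in> X" using block_triangle[OF K.wfK X wX] by blast
        then have "within (adj K) ?N y z" using y by (simp add: within_def)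
        then show ?case
          using rtranclp.rtrancl_into_rtrancl[OF conjunct1[OF step.IH]] \<open>z \<in> X\<close> y(3) by simp
      qed (use ab in simp)
      then show "(within (adj K) ?N)\<^sup>*\<^sup>* a b" by blast
    qed
    show "?N \<noteq> {}" using u0 by blast
    \<comment> \<open>The target has connected links for the same reason as \<open>K\<close>: the
      labels of \<open>g B0\<close> stay connected without \<open>LK w\<close>, and \<open>s\<close>
      is hole-free.\<close>
    show "con s ?V"
      unfolding con_def
    proof (intro ballI)
      fix i j assume ij: "i \<in> ?V" "j \<in> ?V"
      have lab: "LK w \<in> labels (g B0)" "i \<in> labels (g B0) - {LK w}" "j \<in> labels (g B0) - {LK w}"
        using label_rel_labels[of "g B0"] ij irrefl_s by auto
      then have "(within s (labels (g B0) - {LK w}))\<^sup>*\<^sup>* i j" using bicon_s by (simp add: bicon_def con_def)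
      then have "(within s (- {LK w}))\<^sup>*\<^sup>* i j" by (rule within_mono[rotated]) auto
      then have "(link s (LK w))\<^sup>*\<^sup>* i j"
        using link_connected[OF symp_s irrefl_s hole_free_acyclic2[OF symp_s irrefl_s hole_free_s]] ij by simp
      then show "(within s ?V)\<^sup>*\<^sup>* i j" by (simp add: link_def)
    qed
    show "LK ` ?N \<subseteq> ?V" using X_hom wX by blast
    fix u assume u: "u \<in> ?N"
    have "{y \<in> ?N. adj K u y} = {v \<in> X. adj K w v \<and> adj K u v}" by blast
    then show "embeds (adj K) LK {y \<in> ?N. adj K u y} s" "LK ` {y \<in> ?N. adj K u y} = {i \<in> ?V. s (LK u) i}"
      using cn[OF u] by simp_all
  qed
  then show ?thesis by (simp add: star_def)
qed

lemma block_iso: "embeds (adj K) LK X s \<and> LK ` X = labels (g B0)"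
proof (rule cover_iso[OF symp_adj symp_s irrefl_s hole_free_s])
  show "con (adj K) X" using block_bicon[OF K.wfK X] by (simp add: bicon_def)
  show "X \<noteq> {}" by (rule block_nonempty[OF K.wfK X])
  show "con s (labels (g B0))" using bicon_s by (simp add: bicon_def)
  \<comment> \<open>Every vertex of \<open>X\<close> has a neighbour in \<open>X\<close>, and
    \<open>s\<close> relates only labels of \<open>g B0\<close>.\<close>
  show "LK ` X \<subseteq> labels (g B0)"
  proof (rule image_subsetI)
    fix x assume x: "x \<in> X"
    obtain a b where ab: "a \<in> B0" "b \<in> B0" "a \<noteq> b" using BSD(6)[OF B0(1)] by blast
    then obtain c where "c \<in> X" "x \<noteq> c" using B0(2) by (cases "a = x") auto
    then obtain y where "y \<in> X" "adj K x y" using block_neighbour[OF K.wfK X x] by blast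
    then show "LK x \<in> labels (g B0)" using X_hom[OF x] label_rel_labels by blast
  qed
  fix x assume x: "x \<in> X"
  have st: "embeds (adj K) LK {y \<in> X. adj K x y} s" "LK ` {y \<in> X. adj K x y} = {i. s (LK x) i}"
    using star_all[OF x] by (simp_all add: star_def)
  then show "embeds (adj K) LK {y \<in> X. adj K x y} s" by simp
  show "LK ` {y \<in> X. adj K x y} = {i \<in> labels (g B0). s (LK x) i}"
    unfolding st(2) using label_rel_labels[of "g B0"] by blast
qed

lemma block_label_iso: "label_iso (induced K X, LK) (g B0)"
proof (rule embeds_label_iso[OF g_U[OF B0(1)]])
  have v: "verts (induced K X) = X" using block_verts[OF K.wfK X] by (simp add: verts_induced Int_absorb1)
  have "embeds (within (adj K) X) LK X s \<longleftrightarrow> embeds (adj K) LK X s"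
    by (rule embeds_cong) (auto simp: within_def)
  then show "embeds (adj (induced K X)) LK (verts (induced K X)) s" "LK ` verts (induced K X) = labels (g B0)"
    using block_iso by (simp_all add: v adj_induced)
qed

end

section \<open>Membership in the class and the conclusion\<close>

lemma graph_class_label_iso:
  assumes P: "graph_class P" and F: "fst F \<in> P" and wf: "wf_graph J" and iso: "label_iso (J, L) F"
  shows "J \<in> P"
proof -
  obtain f where f: "bij_betw f (verts J) (verts (fst F))"
      "\<And>u v. u \<in> verts J \<Longrightarrow> v \<in> verts J \<Longrightarrow> adj J u v \<longleftrightarrow> adj (fst F) (f u) (f v)"
    using iso by (auto simp: label_iso_def graph_iso_def)
  let ?h = "the_inv_into (verts J) f"
  have h: "bij_betw ?h (verts (fst F)) (verts J)" by (rule bij_betw_the_inv_into[OF f(1)])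
  have "adj (fst F) u v \<longleftrightarrow> adj J (?h u) (?h v)" if uv: "u \<in> verts (fst F)" "v \<in> verts (fst F)" for u v
    using f(2)[OF bij_betwE[OF h, rule_format, OF uv(1)] bij_betwE[OF h, rule_format, OF uv(2)]]
      f_the_inv_into_f_bij_betw[OF f(1), of u] f_the_inv_into_f_bij_betw[OF f(1), of v] uv by simp
  then have "graph_iso (fst F) J ?h" using h by (simp add: graph_iso_def)
  then show ?thesis using P F wf unfolding graph_class_def by blast
qed

lemma compatible_glued:
  assumes "wf_graph G" "wf_graph H" "compatible G LG H LH S"
  shows "glued G H S"
  using assms by unfold_locales (auto simp: compatible_def)

theorem theorem5p1:
  fixes P :: "'v graph set" and d :: nat
    and G1 G2 H :: "'v graph" and L1 L2 LH :: "'v \<Rightarrow> nat" and S :: "'v set"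
    and g :: "'v set \<Rightarrow> 'v graph \<times> ('v \<Rightarrow> nat)" and h :: "'v set \<Rightarrow> nat set"
  assumes "d \<ge> 2"
    and "graph_class P" and "block_hereditary P" and "\<forall>G\<in>P. chordal G"
    and "d_labeled_P_block d P G1 L1" and "S \<subseteq> verts G1"
    and "d_labeled_P_block d P G2 L2" and "S \<subseteq> verts G2"
    and "d_labeled_P_block d P H LH" and "S \<subseteq> verts H"
    and "compatible G1 L1 H LH S" and "compatible G2 L2 H LH S"
    and "characteristic d P G1 L1 S g h" and "characteristic d P G2 L2 S g h"
    and "\<not> has_cycle (aux_sum G2 H S)"
    and "d_labeled_P_block d P (gsum G1 H) (lsum G1 L1 LH)"
    and "respects_char G1 L1 S g H LH"
  shows "d_labeled_P_block d P (gsum G2 H) (lsum G2 L2 LH) \<and> respects_char G2 L2 S g H LH"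
proof -
  let ?K = "gsum G2 H" and ?L = "lsum G2 L2 LH"
  have pb: "P_block_graph P G1" "P_block_graph P G2" "P_block_graph P H" "P_block_graph P (gsum G1 H)"
    and bl: "block_labeling d G2 L2" "block_labeling d H LH"
    using assms(5,7,9,16) by (simp_all add: d_labeled_P_block_def)
  then have wf: "wf_graph G1" "wf_graph G2" "wf_graph H" by (simp_all add: P_block_graph_def)
  interpret M: glued G1 H S by (rule compatible_glued[OF wf(1,3) assms(11)])
  interpret K: glued G2 H S by (rule compatible_glued[OF wf(2,3) assms(12)])
  interpret exchange G1 G2 H S P d L1 L2 LH g h
    by unfold_locales (use assms pb in \<open>auto simp: compatible_def\<close>)
  have iso: "label_iso (induced ?K X, ?L) (g B)" "inj_on ?L X" "g B \<in> U d P"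
    if "X \<in> blocks ?K" "B \<in> block_set G2 S" "B \<subseteq> X" for X B
  proof -
    interpret exchange_block G1 G2 H S P d L1 L2 LH g h X B using that by unfold_locales
    show "label_iso (induced ?K X, ?L) (g B)" by (rule block_label_iso)
    show "inj_on ?L X" using block_iso by (simp add: embeds_def)
    show "g B \<in> U d P" by (rule g_U[OF that(2)])
  qed
  \<comment> \<open>A block with an edge inside \<open>S\<close> contains the member of
    \<open>Block(G2,S)\<close> through that edge, and gets its properties from \<open>g B\<close>.
    Any other block is a block of \<open>G2\<close> or of \<open>H\<close> and keeps the properties
    it has there.\<close>
  have part: "induced ?K X \<in> P \<and> card X \<le> d \<and> inj_on ?L X" if X: "X \<in> blocks ?K" for X
  proof (cases "\<exists>x\<in>X. \<exists>y\<in>X. x \<in> S \<and> y \<in> S \<and> adj ?K x y")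
    case True
    then obtain x y where xy: "x \<in> X" "y \<in> X" "x \<in> S" "y \<in> S" "adj ?K x y" by blast
    then have a: "adj G2 x y" using K.adj_K_G K.SG by blast
    then obtain B where B: "B \<in> block_set G2 S" "x \<in> B" "y \<in> B"
      using S_edge_block_set[OF wf(2) a xy(3,4)] by blast
    have vB: "B \<subseteq> verts G2" using BSD(1)[OF B(1)] K.SG by blast
    have "bicon (adj ?K) B" using BSD(2)[OF B(1)] K.bicon_part[OF vB] by simp
    moreover have "B \<subseteq> verts ?K" using vB by (auto simp: verts_gsum)
    moreover have "x \<noteq> y" using a by auto
    ultimately have BX: "B \<subseteq> X" using block_absorb[OF K.wfK X] B xy(1,2) by blast
    note i = iso[OF X B(1) BX]
    have v: "verts (induced ?K X) = X" using block_verts[OF K.wfK X] by (simp add: verts_induced Int_absorb1)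
    have "induced ?K X \<in> P"
      by (rule graph_class_label_iso[OF assms(2) U_D(3)[OF i(3)] wf_induced[OF K.wfK] i(1)])
    moreover have "card X = card (verts (fst (g B)))"
      using i(1) v by (auto simp: label_iso_def graph_iso_def dest: bij_betw_same_card)
    ultimately show ?thesis using i(2) U_D(4)[OF i(3)] by simp
  next
    case False
    then consider "X \<in> blocks G2" | "X \<in> blocks H"
      using K.block_without_S_edge[OF acyclic2_K X] by blast
    then show ?thesis
    proof cases
      case 1
      have v: "X \<subseteq> verts G2" by (rule block_verts[OF wf(2) 1])
      have "inj_on ?L X \<longleftrightarrow> inj_on L2 X" by (rule inj_on_cong) (use v LK_G2 in blast)
      then show ?thesis
        using 1 bl(1) pb(2) K.induced_part[OF v] by (simp add: block_labeling_def P_block_graph_def)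
    next
      case 2
      have v: "X \<subseteq> verts H" by (rule block_verts[OF wf(3) 2])
      have "inj_on ?L X \<longleftrightarrow> inj_on LH X" by (rule inj_on_cong) (use v LK_H in blast)
      moreover have "induced ?K X = induced H X"
        using glued.induced_part[OF flipK v] by (simp add: gsum_commute[of H G2])
      ultimately show ?thesis
        using 2 bl(2) pb(3) by (simp add: block_labeling_def P_block_graph_def)
    qed
  qed
  have "?L ` verts ?K \<subseteq> {1..d}"
    using bl by (auto simp: block_labeling_def verts_gsum lsum_def)
  then have "d_labeled_P_block d P ?K ?L"
    using part K.wfK by (simp add: d_labeled_P_block_def P_block_graph_def block_labeling_def)
  moreover have "respects_char G2 L2 S g H LH"
    unfolding respects_char_def using iso(1) by blast
  ultimately show ?thesis by blast
qed

end
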